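(* Let $G$ be a Polish group with a dense countable subgroup $G_0$ and a countable graded basis $\mathcal{R}$ consisting of the graded $G_0$-cosets of graded subgroups belonging to $\mathcal{R}$, where all graded subgroups in $\mathcal{R}$ are clopen, $\mathcal{R}$ is closed under $G_0$-conjugation, and the graded subgroups in $\mathcal{R}$ are closed under $\max$ and dotted multiplication by positive rationals. Let $(\mathbf{X},\tau)$ be a Polish $G$-space, $\mathbf{t}$ an $\mathcal{R}$-nice topology on $\mathbf{X}$ with nice basis $\mathcal{B}$. Then a piece $X$ of the canonical partition of $\mathbf{X}$ with respect to $\mathbf{t}$ is a single $G$-orbit if and only if, for every clopen graded subgroup $H\in\mathcal{R}$, every $H$-type of $X$ is principal.
   Context: Graded subset of a space: function $\phi$ to $[0,1]$; $\phi_{<r}=\{\phi<r\}$; open = upper semicontinuous, clopen = continuous. Graded subgroup $H$ of $G$: $H(1)=0$, $H(g)=H(g^{-1})$, $H(gg')\le H(g)+H(g')$; graded coset $Hg_0: g\mapsto H(gg_0^{-1})$; conjugate $H^g: h\mapsto H(ghg^{-1})$. A graded basis of a topology is a family of open graded subsets $\phi$ such that the sets $\phi_{<r}$ ($r\in\mathbb{Q}\cap(0,1)$) form a basis. $\phi\sqsubseteq\mathbf{X}$ is $H$-invariant if $\phi(gx)\le\phi(x)\dot+H(g)$ ($\dot+$ = truncated addition). Vaught transforms for open graded $J\sqsubseteq G$: $\phi^{\Delta J}(x)=\inf\{r\dot+s:\{h:\phi(hx)<r\}$ not meagre in $J_{<s}\}$, $\phi^{*J}(x)=\sup\{r\dot-s:\{h:\phi(hx)\le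 r\}$ not comeagre in $J_{<s}\}$. $\mathcal{B}$ is a nice basis w.r.t. $\mathcal{R}$ if: it is a countable family of Borel graded subsets generating a topology finer than $\tau$; closed under $1-\phi$, $\min,\max,|\phi_1-\phi_2|,\dot-,\dot+$ and dotted multiplication by positive rationals; $\phi^{*\rho},\phi^{\Delta\rho}\in\mathcal{B}$ for $\phi\in\mathcal{B},\rho\in\mathcal{R}$; each $\phi\in\mathcal{B}$ is $H$-invariant for some open graded subgroup $H\in\mathcal{R}$. $\mathbf{t}$ is $\mathcal{R}$-nice with nice basis $\mathcal{B}$ if $\mathbf{t}$ is Polish, finer than $\tau$, the action is $\mathbf{t}$-continuous, and $\mathcal{B}$ is a graded basis of $\mathbf{t}$ which is nice. Canonical partition w.r.t. $\mathbf{t}$: enumerate as $A_0,A_1,\dots$ the basic sets $\phi_{<r}$ ($\phi\in\mathcal{B}$, $r$ rational); for $t\in2^{\mathbb{N}}$ let $Y_t=\bigcap\{GA_j:t(j)=1\}\cap\bigcap\{\mathbf{X}\setminus GA_j:t(j)=0\}$; the pieces are the nonempty $Y_t$. For an open graded subgroup $H\in\mathcal{R}$ and a $G$-invariant $\mathbf{t}$-$G_\delta$ set $X$: an $H$-type in $X$ is a family $\mathcal{F}$ of sets $\phi_{<r}$ with $H$-invariant $\phi\in\mathcal{B}$, maximal subject to $X\cap\bigcap\mathcal{F}\ne\emptyset$. It is principal if for every $\varepsilon>0$ there are an $H$-invariant $\phi\in\mathcal{B}$ and $r$ with $\phi_{<r}\in\mathcal{F}$ such that for each $\psi_{<t}\in\mathcal{F}$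 the set $\psi_{<t+\varepsilon}$ contains $\phi_{<r}\cap X$. *)

theory Defs
  imports "HOL-Analysis.Analysis" "HOL-Algebra.Group_Action"
begin

definition polish_topology :: "'a topology \<Rightarrow> bool" where
  "polish_topology T \<longleftrightarrow> completely_metrizable_space T \<and> second_countable T"

definition finer_topology :: "'a topology \<Rightarrow> 'a topology \<Rightarrow> bool" where
  "finer_topology T' T \<longleftrightarrow>
     topspace T' = topspace T \<and> (\<forall>U. openin T U \<longrightarrow> openin T' U)"

definition nowhere_dense_in :: "'a topology \<Rightarrow> 'a set \<Rightarrow> bool" where
  "nowhere_dense_in T N \<longleftrightarrow> N \<subseteq> topspace T \<and> T interior_of (T closure_of N) = {}"

definition meagre_in :: "'a topology \<Rightarrow> 'a set \<Rightarrow> bool" where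
  "meagre_in T M \<longleftrightarrow>
     (\<exists>\<N>. countable \<N> \<and> (\<forall>N\<in>\<N>. nowhere_dense_in T N) \<and> M = \<Union>\<N>)"

definition meagre_within :: "'a topology \<Rightarrow> 'a set \<Rightarrow> 'a set \<Rightarrow> bool" where
  "meagre_within T S M \<longleftrightarrow> meagre_in (subtopology T S) (M \<inter> S)"

definition comeagre_within :: "'a topology \<Rightarrow> 'a set \<Rightarrow> 'a set \<Rightarrow> bool" where
  "comeagre_within T S M \<longleftrightarrow> meagre_in (subtopology T S) (S - M)"

definition polish_group :: "('g, 'm) monoid_scheme \<Rightarrow> 'g topology \<Rightarrow> bool" where
  "polish_group G TG \<longleftrightarrow>
     group G \<and> topspace TG = carrier G \<and> polish_topology TG \<and>
     continuous_map (prod_topology TG TG) TG (\<lambda>(g, h). g \<otimes>\<^bsub>G\<^esub> h) \<and>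
     continuous_map TG TG (\<lambda>g. inv\<^bsub>G\<^esub> g)"

definition continuous_action ::
  "'g topology \<Rightarrow> 'x topology \<Rightarrow> ('g \<Rightarrow> 'x \<Rightarrow> 'x) \<Rightarrow> bool" where
  "continuous_action TG T act \<longleftrightarrow>
     continuous_map (prod_topology TG T) T (\<lambda>(g, x). act g x)"

definition polish_G_space ::
  "('g, 'm) monoid_scheme \<Rightarrow> 'g topology \<Rightarrow> 'x topology \<Rightarrow> ('g \<Rightarrow> 'x \<Rightarrow> 'x) \<Rightarrow> bool" where
  "polish_G_space G TG T act \<longleftrightarrow>
     polish_topology T \<and> group_action G (topspace T) act \<and> continuous_action TG T act"

definition dot_plus :: "real \<Rightarrow> real \<Rightarrow> real" (infixl "\<dotplus>" 65) where
  "a \<dotplus> b = min (a + b) 1"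

definition dot_minus :: "real \<Rightarrow> real \<Rightarrow> real" (infixl "\<dotminus>" 65) where
  "a \<dotminus> b = max (a - b) 0"

definition dot_times :: "rat \<Rightarrow> real \<Rightarrow> real" where
  "dot_times q a = min (of_rat q * a) 1"

text \<open>Graded subsets of a set are extensional functions, so that two of them are equal as soon as
  they agree on that set. Operations on them are therefore restricted to the underlying set.\<close>

definition graded_subset :: "'a set \<Rightarrow> ('a \<Rightarrow> real) \<Rightarrow> bool" where
  "graded_subset S \<phi> \<longleftrightarrow> \<phi> \<in> S \<rightarrow>\<^sub>E {0..1}"

definition sublevel :: "'a set \<Rightarrow> ('a \<Rightarrow> real) \<Rightarrow> real \<Rightarrow> 'a set" where
  "sublevel S \<phi> r = {x \<in> S. \<phi> x < r}"

definition open_graded :: "'a topology \<Rightarrow> ('a \<Rightarrow> real) \<Rightarrow> bool" where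
  "open_graded T \<phi> \<longleftrightarrow>
     graded_subset (topspace T) \<phi> \<and> (\<forall>r. openin T (sublevel (topspace T) \<phi> r))"

definition clopen_graded :: "'a topology \<Rightarrow> ('a \<Rightarrow> real) \<Rightarrow> bool" where
  "clopen_graded T \<phi> \<longleftrightarrow>
     graded_subset (topspace T) \<phi> \<and> continuous_map T euclideanreal \<phi>"

definition borel_graded :: "'a topology \<Rightarrow> ('a \<Rightarrow> real) \<Rightarrow> bool" where
  "borel_graded T \<phi> \<longleftrightarrow>
     graded_subset (topspace T) \<phi> \<and>
     \<phi> \<in> borel_measurable (sigma (topspace T) {U. openin T U})"

definition rational_sublevels :: "'a set \<Rightarrow> ('a \<Rightarrow> real) set \<Rightarrow> 'a set set" where
  "rational_sublevels S \<F> = {sublevel S \<phi> r | \<phi> r. \<phi> \<in> \<F> \<and> r \<in> \<rat> \<inter> {0<..<1}}"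

definition graded_basis :: "'a topology \<Rightarrow> ('a \<Rightarrow> real) set \<Rightarrow> bool" where
  "graded_basis T \<F> \<longleftrightarrow>
     (\<forall>\<phi>\<in>\<F>. open_graded T \<phi>) \<and>
     openin T = arbitrary union_of (\<lambda>U. U \<in> rational_sublevels (topspace T) \<F>)"

definition graded_subgroup :: "('g, 'm) monoid_scheme \<Rightarrow> ('g \<Rightarrow> real) \<Rightarrow> bool" where
  "graded_subgroup G H \<longleftrightarrow>
     graded_subset (carrier G) H \<and>
     H \<one>\<^bsub>G\<^esub> = 0 \<and>
     (\<forall>g\<in>carrier G. H g = H (inv\<^bsub>G\<^esub> g)) \<and>
     (\<forall>g\<in>carrier G. \<forall>g'\<in>carrier G. H (g \<otimes>\<^bsub>G\<^esub> g') \<le> H g + H g')"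

definition graded_coset :: "('g, 'm) monoid_scheme \<Rightarrow> ('g \<Rightarrow> real) \<Rightarrow> 'g \<Rightarrow> ('g \<Rightarrow> real)" where
  "graded_coset G H g\<^sub>0 = (\<lambda>g\<in>carrier G. H (g \<otimes>\<^bsub>G\<^esub> inv\<^bsub>G\<^esub> g\<^sub>0))"

definition graded_conj :: "('g, 'm) monoid_scheme \<Rightarrow> ('g \<Rightarrow> real) \<Rightarrow> 'g \<Rightarrow> ('g \<Rightarrow> real)" where
  "graded_conj G H g = (\<lambda>h\<in>carrier G. H (g \<otimes>\<^bsub>G\<^esub> h \<otimes>\<^bsub>G\<^esub> inv\<^bsub>G\<^esub> g))"

definition coset_basis ::
  "('g, 'm) monoid_scheme \<Rightarrow> 'g topology \<Rightarrow> 'g set \<Rightarrow> ('g \<Rightarrow> real) set \<Rightarrow> bool" where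
  "coset_basis G TG G\<^sub>0 \<R> \<longleftrightarrow>
     countable \<R> \<and> graded_basis TG \<R> \<and>
     \<R> = {graded_coset G H g\<^sub>0 | H g\<^sub>0. H \<in> \<R> \<and> graded_subgroup G H \<and> g\<^sub>0 \<in> G\<^sub>0} \<and>
     (\<forall>H\<in>\<R>. graded_subgroup G H \<longrightarrow> clopen_graded TG H) \<and>
     (\<forall>\<rho>\<in>\<R>. \<forall>g\<in>G\<^sub>0. graded_conj G \<rho> g \<in> \<R>) \<and>
     (\<forall>H\<in>\<R>. \<forall>H'\<in>\<R>. graded_subgroup G H \<longrightarrow> graded_subgroup G H' \<longrightarrow>
        (\<lambda>g\<in>carrier G. max (H g) (H' g)) \<in> \<R>) \<and>
     (\<forall>H\<in>\<R>. graded_subgroup G H \<longrightarrow>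
        (\<forall>q>0. (\<lambda>g\<in>carrier G. dot_times q (H g)) \<in> \<R>))"

definition graded_invariant ::
  "('g, 'm) monoid_scheme \<Rightarrow> 'x set \<Rightarrow> ('g \<Rightarrow> 'x \<Rightarrow> 'x) \<Rightarrow> ('g \<Rightarrow> real) \<Rightarrow> ('x \<Rightarrow> real) \<Rightarrow> bool" where
  "graded_invariant G S act H \<phi> \<longleftrightarrow>
     (\<forall>g\<in>carrier G. \<forall>x\<in>S. \<phi> (act g x) \<le> \<phi> x \<dotplus> H g)"

text \<open>Infima and suprema are taken in the unit interval, where the infimum of the empty set is 1
  and its supremum is 0; the inserted elements 1 and 0 encode this convention.\<close>

definition vaught_delta ::
  "'g topology \<Rightarrow> 'x set \<Rightarrow> ('g \<Rightarrow> 'x \<Rightarrow> 'x) \<Rightarrow> ('x \<Rightarrow> real) \<Rightarrow> ('g \<Rightarrow> real) \<Rightarrow> ('x \<Rightarrow> real)" where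
  "vaught_delta TG S act \<phi> J =
     (\<lambda>x\<in>S. Inf (insert 1 {r \<dotplus> s | r s. r \<in> {0..1} \<and> s \<in> {0..1} \<and>
        \<not> meagre_within TG (sublevel (topspace TG) J s) {h \<in> topspace TG. \<phi> (act h x) < r}}))"

definition vaught_star ::
  "'g topology \<Rightarrow> 'x set \<Rightarrow> ('g \<Rightarrow> 'x \<Rightarrow> 'x) \<Rightarrow> ('x \<Rightarrow> real) \<Rightarrow> ('g \<Rightarrow> real) \<Rightarrow> ('x \<Rightarrow> real)" where
  "vaught_star TG S act \<phi> J =
     (\<lambda>x\<in>S. Sup (insert 0 {r \<dotminus> s | r s. r \<in> {0..1} \<and> s \<in> {0..1} \<and>
        \<not> comeagre_within TG (sublevel (topspace TG) J s) {h \<in> topspace TG. \<phi> (act h x) \<le> r}}))"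

definition nice_basis ::
  "('g, 'm) monoid_scheme \<Rightarrow> 'g topology \<Rightarrow> ('g \<Rightarrow> real) set \<Rightarrow> 'x topology \<Rightarrow>
   ('g \<Rightarrow> 'x \<Rightarrow> 'x) \<Rightarrow> ('x \<Rightarrow> real) set \<Rightarrow> bool" where
  "nice_basis G TG \<R> \<tau> act \<B> \<longleftrightarrow>
     countable \<B> \<and> (\<forall>\<phi>\<in>\<B>. borel_graded \<tau> \<phi>) \<and>
     finer_topology (topology_generated_by (rational_sublevels (topspace \<tau>) \<B>)) \<tau> \<and>
     (\<forall>\<phi>\<in>\<B>. (\<lambda>x\<in>topspace \<tau>. 1 - \<phi> x) \<in> \<B>) \<and>
     (\<forall>\<phi>\<in>\<B>. \<forall>\<psi>\<in>\<B>.
        (\<lambda>x\<in>topspace \<tau>. min (\<phi> x) (\<psi> x)) \<in> \<B> \<and>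
        (\<lambda>x\<in>topspace \<tau>. max (\<phi> x) (\<psi> x)) \<in> \<B> \<and>
        (\<lambda>x\<in>topspace \<tau>. \<bar>\<phi> x - \<psi> x\<bar>) \<in> \<B> \<and>
        (\<lambda>x\<in>topspace \<tau>. \<phi> x \<dotminus> \<psi> x) \<in> \<B> \<and>
        (\<lambda>x\<in>topspace \<tau>. \<phi> x \<dotplus> \<psi> x) \<in> \<B>) \<and>
     (\<forall>\<phi>\<in>\<B>. \<forall>q>0. (\<lambda>x\<in>topspace \<tau>. dot_times q (\<phi> x)) \<in> \<B>) \<and>
     (\<forall>\<phi>\<in>\<B>. \<forall>\<rho>\<in>\<R>.
        vaught_star TG (topspace \<tau>) act \<phi> \<rho> \<in> \<B> \<and>
        vaught_delta TG (topspace \<tau>) act \<phi> \<rho> \<in> \<B>) \<and>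
     (\<forall>\<phi>\<in>\<B>. \<exists>H\<in>\<R>. graded_subgroup G H \<and> open_graded TG H \<and>
        graded_invariant G (topspace \<tau>) act H \<phi>)"

definition nice_topology ::
  "('g, 'm) monoid_scheme \<Rightarrow> 'g topology \<Rightarrow> ('g \<Rightarrow> real) set \<Rightarrow> 'x topology \<Rightarrow>
   ('g \<Rightarrow> 'x \<Rightarrow> 'x) \<Rightarrow> 'x topology \<Rightarrow> ('x \<Rightarrow> real) set \<Rightarrow> bool" where
  "nice_topology G TG \<R> \<tau> act \<t> \<B> \<longleftrightarrow>
     polish_topology \<t> \<and> finer_topology \<t> \<tau> \<and> continuous_action TG \<t> act \<and>
     graded_basis \<t> \<B> \<and> nice_basis G TG \<R> \<tau> act \<B>"

definition saturation ::
  "('g, 'm) monoid_scheme \<Rightarrow> ('g \<Rightarrow> 'x \<Rightarrow> 'x) \<Rightarrow> 'x set \<Rightarrow> 'x set" where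
  "saturation G act A = (\<Union>g\<in>carrier G. act g ` A)"

definition basic_enumeration :: "'x set \<Rightarrow> ('x \<Rightarrow> real) set \<Rightarrow> (nat \<Rightarrow> 'x set) \<Rightarrow> bool" where
  "basic_enumeration S \<B> A \<longleftrightarrow> range A = {sublevel S \<phi> r | \<phi> r. \<phi> \<in> \<B> \<and> r \<in> \<rat>}"

definition canonical_set ::
  "('g, 'm) monoid_scheme \<Rightarrow> 'x set \<Rightarrow> ('g \<Rightarrow> 'x \<Rightarrow> 'x) \<Rightarrow> (nat \<Rightarrow> 'x set) \<Rightarrow> (nat \<Rightarrow> bool) \<Rightarrow> 'x set" where
  "canonical_set G S act A t =
     S \<inter> (\<Inter>j\<in>{j. t j}. saturation G act (A j)) \<inter> (\<Inter>j\<in>{j. \<not> t j}. S - saturation G act (A j))"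

definition canonical_partition ::
  "('g, 'm) monoid_scheme \<Rightarrow> 'x set \<Rightarrow> ('g \<Rightarrow> 'x \<Rightarrow> 'x) \<Rightarrow> (nat \<Rightarrow> 'x set) \<Rightarrow> 'x set set" where
  "canonical_partition G S act A = {canonical_set G S act A t | t. canonical_set G S act A t \<noteq> {}}"

definition type_family ::
  "('g, 'm) monoid_scheme \<Rightarrow> 'x set \<Rightarrow> ('g \<Rightarrow> 'x \<Rightarrow> 'x) \<Rightarrow> ('x \<Rightarrow> real) set \<Rightarrow>
   ('g \<Rightarrow> real) \<Rightarrow> 'x set \<Rightarrow> 'x set set \<Rightarrow> bool" where
  "type_family G S act \<B> H X \<F> \<longleftrightarrow>
     \<F> \<subseteq> {sublevel S \<phi> r | \<phi> r. \<phi> \<in> \<B> \<and> graded_invariant G S act H \<phi>} \<and> X \<inter> \<Inter>\<F> \<noteq> {}"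

definition is_H_type ::
  "('g, 'm) monoid_scheme \<Rightarrow> 'x set \<Rightarrow> ('g \<Rightarrow> 'x \<Rightarrow> 'x) \<Rightarrow> ('x \<Rightarrow> real) set \<Rightarrow>
   ('g \<Rightarrow> real) \<Rightarrow> 'x set \<Rightarrow> 'x set set \<Rightarrow> bool" where
  "is_H_type G S act \<B> H X \<F> \<longleftrightarrow>
     type_family G S act \<B> H X \<F> \<and>
     (\<forall>\<F>'. type_family G S act \<B> H X \<F>' \<and> \<F> \<subseteq> \<F>' \<longrightarrow> \<F>' = \<F>)"

definition principal_H_type ::
  "('g, 'm) monoid_scheme \<Rightarrow> 'x set \<Rightarrow> ('g \<Rightarrow> 'x \<Rightarrow> 'x) \<Rightarrow> ('x \<Rightarrow> real) set \<Rightarrow>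
   ('g \<Rightarrow> real) \<Rightarrow> 'x set \<Rightarrow> 'x set set \<Rightarrow> bool" where
  "principal_H_type G S act \<B> H X \<F> \<longleftrightarrow>
     (\<forall>\<epsilon>>0. \<exists>\<phi>\<in>\<B>. \<exists>r. graded_invariant G S act H \<phi> \<and> sublevel S \<phi> r \<in> \<F> \<and>
        (\<forall>\<psi>\<in>\<B>. \<forall>t. graded_invariant G S act H \<psi> \<and> sublevel S \<psi> t \<in> \<F> \<longrightarrow>
           sublevel S \<phi> r \<inter> X \<subseteq> sublevel S \<psi> (t + \<epsilon>)))"

end

theory Submission
  imports Defs
begin

text \<open>Every orbit in a piece \<open>X\<close> is dense in \<open>X\<close>, and the \<open>H\<close>-types in \<open>X\<close> are exactly the families
  of \<open>H\<close>-invariant basic sets that contain a given point of \<open>X\<close>. Basic functions being continuous,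
  \<open>\<phi>\<^sup>\<Delta>\<^sup>H(x)\<close> is the truncated infimum of \<open>\<phi>(hx) + H(h)\<close>; it is \<open>H\<close>-invariant, and feeding suitably
  shifted and rescaled basic functions into it shows that principality of the \<open>H\<close>-types amounts to
  the sets \<open>Ux\<close> being dense in a neighbourhood of \<open>x\<close>, for \<open>U\<close> a neighbourhood of the identity.
  A back-and-forth argument in a complete metric of \<open>G\<close> upgrades this to \<open>Ux\<close> being a neighbourhood
  of \<open>x\<close>, so orbits are open in \<open>X\<close> and, being dense, coincide. Conversely, on a single orbit Baire
  category yields the local density, the same upgrade is Effros' theorem, and it makes all types
  principal.\<close>

section \<open>Successive approximation in a complete metric space\<close>

text \<open>The steps are dominated by a geometric series with sum \<open>\<delta>\<close>, so the
  sequence is Cauchy and never leaves the closed ball of that radius around its first term. This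
  confines the limits of the back-and-forth construction to a prescribed neighbourhood of the
  identity.\<close>

lemma (in Metric_space) geometric_sequence_limit:
  assumes "mcomplete" and "range a \<subseteq> M" and \<delta>: "\<delta> > 0"
    and step: "\<And>k. d (a k) (a (Suc k)) \<le> \<delta> / 2 ^ Suc k"
  obtains l where "limitin mtopology a l sequentially" "l \<in> mcball (a 0) \<delta>"
proof -
  have aM: "a k \<in> M" for k using assms(2) by blast
  \<comment> \<open>The subtracted tail lets the induction close; the bound
    \<open>\<delta> / 2 ^ m\<close> alone would not be preserved.\<close>
  have *: "d (a m) (a (m + k)) \<le> \<delta> / 2 ^ m - \<delta> / 2 ^ (m + k)" for m k
  proof (induction k)
    case 0 then show ?case by (simp add: aM)
  next
    case (Suc k)
    have "d (a m) (a (m + Suc k)) \<le> d (a m) (a (m + k)) + d (a (m + k)) (a (Suc (m + k)))"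
      using triangle[of "a m" "a (m+k)" "a (Suc (m+k))"] aM by simp
    also have "\<dots> \<le> (\<delta> / 2 ^ m - \<delta> / 2 ^ (m + k)) + \<delta> / 2 ^ Suc (m + k)"
      using Suc step[of "m+k"] by linarith
    also have "\<dots> = \<delta> / 2 ^ m - \<delta> / 2 ^ (m + Suc k)" by (simp add: field_simps)
    finally show ?case .
  qed
  have **: "d (a m) (a n) < \<delta> / 2 ^ m" if "m \<le> n" for m n
  proof -
    have "0 < \<delta> / 2 ^ (m + (n - m))" using \<delta> by simp
    then show ?thesis using *[of m "n - m"] that by simp
  qed
  have "MCauchy a"
    unfolding MCauchy_def
  proof (intro conjI allI impI)
    fix e :: real assume "e > 0"
    then obtain N where N: "(1/2) ^ N < e / \<delta>"
      using real_arch_pow_inv[of "e / \<delta>" "1/2"] \<delta> by auto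
    then have N: "\<delta> / 2 ^ N < e" using \<delta> by (simp add: field_simps)
    have "d (a n) (a n') < e" if "N \<le> n" "n \<le> n'" for n n'
    proof -
      have "\<delta> / 2 ^ n \<le> \<delta> / 2 ^ N"
        using that \<delta> by (intro divide_left_mono) (auto intro: power_increasing)
      then show ?thesis using **[OF that(2)] N by linarith
    qed
    then show "\<exists>N. \<forall>n n'. N \<le> n \<longrightarrow> N \<le> n' \<longrightarrow> d (a n) (a n') < e"
      by (metis commute nle_le)
  qed (use assms in auto)
  then obtain l where l: "limitin mtopology a l sequentially"
    using assms(1) mcomplete_def by blast
  have "l \<in> mcball (a 0) \<delta>"
  proof (rule limitin_closedin[OF l closedin_mcball])
    have "a n \<in> mcball (a 0) \<delta>" for n using **[of 0 n] aM by (simp add: less_imp_le)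
    then show "\<forall>\<^sub>F n in sequentially. a n \<in> mcball (a 0) \<delta>" by simp
  qed simp
  with l that show thesis by blast
qed

section \<open>Continuous group actions: from locally dense to locally open orbits\<close>

locale continuous_group_action = group G for G (structure) +
  fixes TG :: "'a topology" and T :: "'x topology" and act :: "'a \<Rightarrow> 'x \<Rightarrow> 'x"
  assumes topspace_group: "topspace TG = carrier G"
    and continuous_mult: "continuous_map (prod_topology TG TG) TG (\<lambda>(g, h). g \<otimes> h)"
    and continuous_inv: "continuous_map TG TG (\<lambda>g. inv g)"
    and continuous_act: "continuous_action TG T act"
    and act_one: "x \<in> topspace T \<Longrightarrow> act \<one> x = x"
    and act_mult: "\<lbrakk>g \<in> carrier G; h \<in> carrier G; x \<in> topspace T\<rbrakk>
                    \<Longrightarrow> act (g \<otimes> h) x = act g (act h x)"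
begin

lemma continuous_orbit_map:
  assumes "x \<in> topspace T" shows "continuous_map TG T (\<lambda>g. act g x)"
proof -
  have "continuous_map TG (prod_topology TG T) (\<lambda>g. (g, x))"
    using assms by (simp add: continuous_map_paired)
  from continuous_map_compose[OF this continuous_act[unfolded continuous_action_def]]
  show ?thesis by (simp add: o_def)
qed

lemma continuous_translation:
  assumes "g \<in> carrier G" shows "continuous_map T T (act g)"
proof -
  have "continuous_map T (prod_topology TG T) (\<lambda>x. (g, x))"
    using assms by (simp add: continuous_map_paired topspace_group)
  from continuous_map_compose[OF this continuous_act[unfolded continuous_action_def]]
  show ?thesis by (simp add: o_def)
qed

lemma continuous_right_mult:
  assumes "g \<in> carrier G" shows "continuous_map TG TG (\<lambda>h. h \<otimes> g)"
proof -
  have "continuous_map TG (prod_topology TG TG) (\<lambda>h. (h, g))"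
    using assms by (simp add: continuous_map_paired topspace_group)
  from continuous_map_compose[OF this continuous_mult]
  show ?thesis by (simp add: o_def)
qed

lemma act_closed: "\<lbrakk>g \<in> carrier G; x \<in> topspace T\<rbrakk> \<Longrightarrow> act g x \<in> topspace T"
  using continuous_translation by (metis continuous_map_image_subset_topspace image_subset_iff)

lemma act_inv_act [simp]: "\<lbrakk>g \<in> carrier G; x \<in> topspace T\<rbrakk> \<Longrightarrow> act (inv g) (act g x) = x"
  by (metis act_mult act_one inv_closed l_inv)

lemma act_act_inv [simp]: "\<lbrakk>g \<in> carrier G; x \<in> topspace T\<rbrakk> \<Longrightarrow> act g (act (inv g) x) = x"
  by (metis act_mult act_one inv_closed r_inv)

lemma homeomorphic_translation:
  assumes "g \<in> carrier G" shows "homeomorphic_map T T (act g)"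
proof -
  have "homeomorphic_maps T T (act g) (act (inv g))"
    using assms by (simp add: homeomorphic_maps_def continuous_translation)
  then show ?thesis using homeomorphic_maps_map by blast
qed

lemma open_in_group_subset: "openin TG U \<Longrightarrow> U \<subseteq> carrier G"
  using openin_subset topspace_group by blast

lemma one_in_topspace: "\<one> \<in> topspace TG"
  by (simp add: topspace_group)

text \<open>Continuity of \<open>inv h \<otimes> g\<close> at the identity. If
  \<open>act g x = act h y\<close> with \<open>g\<close> and \<open>h\<close> in \<open>V\<close>,
  then \<open>y\<close> is moved from \<open>x\<close> by an element of \<open>U\<close>; common
  points of two partial orbits are used in this way.\<close>

lemma open_left_quotient_nbhd:
  assumes "openin TG U" "\<one> \<in> U"
  obtains V where "openin TG V" "\<one> \<in> V" "\<And>g h. \<lbrakk>g \<in> V; h \<in> V\<rbrakk> \<Longrightarrow> inv h \<otimes> g \<in> U"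
proof -
  have "continuous_map (prod_topology TG TG) (prod_topology TG TG) (\<lambda>p. (inv (fst p), snd p))"
    by (intro continuous_map_pairedI continuous_map_snd
          continuous_map_compose[OF continuous_map_fst continuous_inv, unfolded o_def])
  from continuous_map_compose[OF this continuous_mult]
  have "continuous_map (prod_topology TG TG) TG (\<lambda>p. inv (fst p) \<otimes> snd p)"
    by (simp add: o_def)
  from openin_continuous_map_preimage[OF this assms(1)]
  have "openin (prod_topology TG TG)
          {p \<in> topspace (prod_topology TG TG). inv (fst p) \<otimes> snd p \<in> U}" (is "openin _ ?S") .
  moreover have "(\<one>, \<one>) \<in> ?S"
    using assms by (simp add: topspace_group)
  ultimately have "\<exists>V W. openin TG V \<and> openin TG W \<and> \<one> \<in> V \<and> \<one> \<in> W \<and> V \<times> W \<subseteq> ?S"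
    by (simp only: openin_prod_topology_alt)
  then obtain V W where VW: "openin TG V" "openin TG W" "\<one> \<in> V" "\<one> \<in> W" "V \<times> W \<subseteq> ?S"
    by blast
  show thesis
  proof (rule that[of "V \<inter> W"])
    show "openin TG (V \<inter> W)" using VW by blast
    fix g h assume "g \<in> V \<inter> W" "h \<in> V \<inter> W"
    then have "(h, g) \<in> V \<times> W" by blast
    then show "inv h \<otimes> g \<in> U" using VW(5) by auto
  qed (use VW in auto)
qed

text \<open>A back-and-forth version of the successive approximation in Banach's open mapping theorem:
  a point \<open>y\<close> near \<open>x\<close> is moved close to \<open>x\<close> and \<open>x\<close> close to the moved \<open>y\<close> alternately, the
  even terms \<open>p (2 * n)\<close> acting on \<open>x\<close> and the odd ones on \<open>y\<close>; both subsequences converge in the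
  complete metric of the group.\<close>

theorem locally_dense_imp_locally_open_orbit:
  assumes complete: "completely_metrizable_space TG" and metrizable: "metrizable_space T"
    and dense: "\<And>x U. \<lbrakk>x \<in> topspace T; openin TG U; \<one> \<in> U\<rbrakk>
           \<Longrightarrow> x \<in> T interior_of (T closure_of ((\<lambda>g. act g x) ` U))"
    and x: "x \<in> topspace T" and U: "openin TG U" "\<one> \<in> U"
  shows "x \<in> T interior_of ((\<lambda>g. act g x) ` U)"
proof -
  obtain M d where MG: "Metric_space M d" "Metric_space.mcomplete M d"
    and TG_eq: "TG = Metric_space.mtopology M d"
    using complete unfolding completely_metrizable_space_def by blast
  interpret mg: Metric_space M d by fact
  obtain N e where MT: "Metric_space N e" and T_eq: "T = Metric_space.mtopology N e"
    using metrizable unfolding metrizable_space_def by blast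
  interpret mt: Metric_space N e by fact
  have M: "M = carrier G" using topspace_group TG_eq by simp
  have N: "N = topspace T" using T_eq by simp
  obtain V where V: "openin TG V" "\<one> \<in> V" "\<And>g h. \<lbrakk>g \<in> V; h \<in> V\<rbrakk> \<Longrightarrow> inv h \<otimes> g \<in> U"
    using open_left_quotient_nbhd[OF U] by blast
  obtain \<delta> where \<delta>: "\<delta> > 0" "mg.mcball \<one> \<delta> \<subseteq> V"
    using V(1,2) unfolding TG_eq mg.openin_mtopology_mcball by blast
  \<comment> \<open>The complete metric \<open>d\<close> need not be invariant, so how small
    \<open>v\<close> must be depends on the current group element \<open>p\<close> as well as on the
    point \<open>z\<close>.\<close>
  have "\<exists>W. openin TG W \<and> \<one> \<in> W \<and>
          (\<forall>v\<in>W. d p (v \<otimes> p) < \<delta> / 2 ^ Suc n \<and> e z (act v z) < 1 / 2 ^ n)"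
    if "p \<in> carrier G" "z \<in> topspace T" for n :: nat and p z
  proof -
    let ?A = "{v \<in> topspace TG. v \<otimes> p \<in> mg.mball p (\<delta> / 2 ^ Suc n)}"
    let ?B = "{v \<in> topspace TG. act v z \<in> mt.mball z (1 / 2 ^ n)}"
    have "openin TG ?A"
      using openin_continuous_map_preimage[OF continuous_right_mult[OF that(1)]] TG_eq by blast
    moreover have "openin TG ?B"
      using openin_continuous_map_preimage[OF continuous_orbit_map[OF that(2)]] T_eq by blast
    moreover have "\<one> \<in> ?A \<inter> ?B"
      using that \<delta>(1) by (simp add: one_in_topspace act_one flip: M N)
    ultimately show ?thesis
      by (intro exI[of _ "?A \<inter> ?B"]) auto
  qed
  note ex_nbhd = this
  define W where "W n p z = (SOME W. openin TG W \<and> \<one> \<in> W \<and>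
      (\<forall>v\<in>W. d p (v \<otimes> p) < \<delta> / 2 ^ Suc n \<and> e z (act v z) < 1 / 2 ^ n))" for n p z
  have W: "openin TG (W n p z) \<and> \<one> \<in> W n p z \<and>
      (\<forall>v\<in>W n p z. d p (v \<otimes> p) < \<delta> / 2 ^ Suc n \<and> e z (act v z) < 1 / 2 ^ n)"
    if "p \<in> carrier G" "z \<in> topspace T" for n p z
    unfolding W_def by (rule someI_ex[OF ex_nbhd[OF that]])
  define nb where "nb n p z = T interior_of (T closure_of ((\<lambda>g. act g z) ` W n p z))" for n p z
  have "nb 0 \<one> x \<subseteq> (\<lambda>g. act g x) ` U"
  proof
    fix y assume y: "y \<in> nb 0 \<one> x"
    then have yT: "y \<in> topspace T"
      unfolding nb_def by (rule subsetD[OF interior_of_subset_topspace])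
    define c where "c n = (if even n then x else y)" for n :: nat
    have cT: "c n \<in> topspace T" for n using x yT by (simp add: c_def)
    \<comment> \<open>A state is a pair of consecutive terms. The invariant puts the point moved by
      the newer term into a region where the partial orbit of the other point is dense. At stage 0
      both terms are the identity, and it says that \<open>y\<close> lies in
      \<open>nb 0 \<one> x\<close>.\<close>
    define P where "P n = (\<lambda>(p, q). p \<in> carrier G \<and> q \<in> carrier G \<and>
        act q (c (Suc n)) \<in> nb n p (act p (c n)) \<and> (n = 0 \<longrightarrow> p = \<one> \<and> q = \<one>))" for n
    define Q where "Q n = (\<lambda>(p :: 'a, q :: 'a) (p' :: 'a, q' :: 'a). p' = q \<and> (\<exists>v \<in> W n p (act p (c n)). q' = v \<otimes> p))" for n
    have "\<exists>f. \<forall>n. P n (f n) \<and> Q n (f n) (f (Suc n))"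
    proof (rule dependent_nat_choice)
      have "P 0 (\<one>, \<one>)" using y x yT by (simp add: P_def c_def act_one)
      then show "\<exists>s. P 0 s" by blast
    next
      fix s n assume s: "P n s"
      obtain p q where s_eq: "s = (p, q)" by force
      have pq: "p \<in> carrier G" "q \<in> carrier G" and near: "act q (c (Suc n)) \<in> nb n p (act p (c n))"
        using s unfolding s_eq P_def by auto
      let ?z = "act p (c n)" let ?z' = "act q (c (Suc n))"
      have zT: "?z \<in> topspace T" "?z' \<in> topspace T" using pq cT act_closed by auto
      \<comment> \<open>By local density at \<open>?z'\<close>, the open set
        \<open>nb (Suc n) q ?z'\<close> is a neighbourhood of \<open>?z'\<close>, which is itself in
        the closure of the partial orbit of \<open>?z\<close>. So some \<open>v\<close> moves
        \<open>?z\<close> into that set, and the two points exchange roles.\<close>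
      have "?z' \<in> nb (Suc n) q ?z'"
        unfolding nb_def using dense zT W[OF pq(2) zT(2)] by blast
      moreover have "openin T (nb (Suc n) q ?z')" unfolding nb_def by simp
      moreover have "?z' \<in> T closure_of ((\<lambda>g. act g ?z) ` W n p ?z)"
        using near unfolding nb_def by (rule subsetD[OF interior_of_subset])
      ultimately obtain v where v: "v \<in> W n p ?z" "act v ?z \<in> nb (Suc n) q ?z'"
        unfolding in_closure_of by blast
      have vG: "v \<in> carrier G" using v(1) W[OF pq(1) zT(1)] open_in_group_subset by blast
      have "P (Suc n) (q, v \<otimes> p)"
        unfolding P_def using pq vG v(2) cT[of n] by (simp add: act_mult c_def)
      moreover have "Q n s (q, v \<otimes> p)" unfolding Q_def s_eq using v by auto
      ultimately show "\<exists>s'. P (Suc n) s' \<and> Q n s s'" by blast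
    qed
    then obtain f where f: "\<And>n. P n (f n)" "\<And>n. Q n (f n) (f (Suc n))" by blast
    define p where "p n = fst (f n)" for n
    have f_eq: "f n = (p n, p (Suc n))" for n
      using f(2)[of n] unfolding Q_def p_def by (auto split: prod.splits)
    have pG: "p n \<in> carrier G" for n using f(1)[of n] unfolding P_def f_eq by auto
    have pT: "act (p n) (c n) \<in> topspace T" for n using pG cT act_closed by auto
    have near: "act (p (Suc n)) (c (Suc n)) \<in> nb n (p n) (act (p n) (c n))" for n
      using f(1)[of n] unfolding P_def f_eq by auto
    have step: "d (p n) (p (Suc (Suc n))) < \<delta> / 2 ^ Suc n" for n
      using f(2)[of n] W[OF pG pT, of n n n] unfolding Q_def f_eq by auto
    have p01: "p 0 = \<one>" "p 1 = \<one>"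
      using f(1)[of 0] unfolding P_def f_eq by auto
    \<comment> \<open>The terms with \<open>i = 0\<close> act on \<open>x\<close>, those with
      \<open>i = 1\<close> on \<open>y\<close>. Both subsequences start at the identity.\<close>
    have lim: "\<exists>l. limitin TG (\<lambda>k. p (2 * k + i)) l sequentially \<and> l \<in> V" if "i \<le> 1" for i
    proof -
      have "d (p (2 * k + i)) (p (2 * Suc k + i)) \<le> \<delta> / 2 ^ Suc k" for k
      proof -
        have "\<delta> / 2 ^ Suc (2 * k + i) \<le> \<delta> / 2 ^ Suc k"
          using \<delta>(1) by (intro divide_left_mono power_increasing) auto
        then show ?thesis using step[of "2 * k + i"] by simp
      qed
      moreover have "range (\<lambda>k. p (2 * k + i)) \<subseteq> M" using pG M by blast
      ultimately obtain l where "limitin TG (\<lambda>k. p (2 * k + i)) l sequentially"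
          "l \<in> mg.mcball (p (2 * 0 + i)) \<delta>"
        using mg.geometric_sequence_limit[OF MG(2) _ \<delta>(1), of "\<lambda>k. p (2 * k + i)"]
        unfolding TG_eq by blast
      moreover have "p (2 * 0 + i) = \<one>" using p01 that by (cases i) auto
      ultimately show ?thesis using \<delta>(2) by auto
    qed
    obtain g where g: "limitin TG (\<lambda>k. p (2 * k)) g sequentially" "g \<in> V" using lim[of 0] by auto
    obtain h where h: "limitin TG (\<lambda>k. p (2 * k + 1)) h sequentially" "h \<in> V" using lim[of 1] by auto
    have gh: "g \<in> carrier G" "h \<in> carrier G" using g h V(1) open_in_group_subset by auto
    have gx: "act g x \<in> N" "act h y \<in> N" using gh x yT act_closed N by auto
    \<comment> \<open>The next point is only known to be in the closure of the partial orbit, hence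
      the passage to closed balls.\<close>
    have e_near: "e (act (p n) (c n)) (act (p (Suc n)) (c (Suc n))) \<le> 1 / 2 ^ n" for n
    proof -
      let ?z = "act (p n) (c n)"
      have "(\<lambda>g. act g ?z) ` W n (p n) ?z \<subseteq> mt.mcball ?z (1 / 2 ^ n)"
      proof
        fix z' assume "z' \<in> (\<lambda>g. act g ?z) ` W n (p n) ?z"
        then obtain v where v: "v \<in> W n (p n) ?z" "z' = act v ?z" by blast
        have "v \<in> carrier G" "e ?z (act v ?z) < 1 / 2 ^ n"
          using W[OF pG pT, of n n n] v(1) open_in_group_subset by blast+
        then show "z' \<in> mt.mcball ?z (1 / 2 ^ n)"
          using pT[of n] act_closed[of v ?z] v(2) by (simp add: mt.in_mcball flip: N)
      qed
      then have "T closure_of ((\<lambda>g. act g ?z) ` W n (p n) ?z) \<subseteq> mt.mcball ?z (1 / 2 ^ n)"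
        unfolding T_eq by (rule closure_of_minimal[OF _ mt.closedin_mcball])
      moreover have "act (p (Suc n)) (c (Suc n)) \<in> T closure_of ((\<lambda>g. act g ?z) ` W n (p n) ?z)"
        using near[of n] unfolding nb_def by (rule subsetD[OF interior_of_subset])
      ultimately have "act (p (Suc n)) (c (Suc n)) \<in> mt.mcball ?z (1 / 2 ^ n)" by (rule subsetD)
      then show ?thesis by (simp only: mt.in_mcball)
    qed
    have "limitin T (\<lambda>k. act (p (2 * k)) x) (act g x) sequentially"
      using continuous_map_limit[OF continuous_orbit_map[OF x] g(1)] by (simp add: o_def)
    then have 1: "(\<lambda>k. e (act (p (2 * k)) x) (act g x)) \<longlonglongrightarrow> 0"
      unfolding T_eq mt.limitin_metric_dist_null by blast
    have "limitin T (\<lambda>k. act (p (2 * k + 1)) y) (act h y) sequentially"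
      using continuous_map_limit[OF continuous_orbit_map[OF yT] h(1)] by (simp add: o_def)
    then have 2: "(\<lambda>k. e (act (p (2 * k + 1)) y) (act h y)) \<longlonglongrightarrow> 0"
      unfolding T_eq mt.limitin_metric_dist_null by blast
    have 3: "(\<lambda>k. (1/2::real) ^ k) \<longlonglongrightarrow> 0" by (simp add: LIMSEQ_realpow_zero)
    \<comment> \<open>Each of the three terms on the right tends to 0, so the two limit points
      coincide.\<close>
    have "e (act g x) (act h y) \<le>
        e (act (p (2 * k)) x) (act g x) + (1/2) ^ k + e (act (p (2 * k + 1)) y) (act h y)" for k
    proof -
      let ?a = "act (p (2 * k)) x" and ?b = "act (p (2 * k + 1)) y"
      have ab: "?a \<in> N" "?b \<in> N" using pG x yT act_closed N by auto
      have "e ?a ?b \<le> 1 / 2 ^ (2 * k)" using e_near[of "2 * k"] by (simp add: c_def)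
      also have "\<dots> \<le> 1 / 2 ^ k" by (intro divide_left_mono power_increasing) auto
      finally have "e ?a ?b \<le> (1/2) ^ k" by (simp add: power_one_over)
      moreover have "e (act g x) (act h y) \<le> e (act g x) ?a + e ?a (act h y)"
        "e ?a (act h y) \<le> e ?a ?b + e ?b (act h y)"
        using mt.triangle gx ab by auto
      ultimately show ?thesis using mt.commute[of "act g x" ?a] by linarith
    qed
    then have "e (act g x) (act h y) \<le> 0"
      using tendsto_lowerbound[OF tendsto_add[OF tendsto_add[OF 1 3] 2], of "e (act g x) (act h y)"]
      by simp
    then have "act g x = act h y" using gx mt.nonneg[of "act g x" "act h y"] mt.zero by simp
    then have "y = act (inv h \<otimes> g) x" using gh x yT by (simp add: act_mult)
    then show "y \<in> (\<lambda>g. act g x) ` U" using V(3) g h by blast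
  qed
  moreover have "x \<in> nb 0 \<one> x" "openin T (nb 0 \<one> x)"
    unfolding nb_def using dense x W[of \<one> x 0] by auto
  ultimately show ?thesis
    using interior_of_maximal[of "nb 0 \<one> x"] by blast
qed

end

section \<open>Baire category and transitive actions\<close>

lemma closure_of_meets_open:
  "\<lbrakk>z \<in> T closure_of A; openin T W; z \<in> W\<rbrakk> \<Longrightarrow> \<exists>y\<in>A. y \<in> W"
  by (auto simp: in_closure_of)

context continuous_group_action
begin

text \<open>Countably many translates of the closure of \<open>Vx\<close> cover the space, so by
  Baire category this closure has nonempty interior. The interior contains \<open>act v x\<close>
  for some \<open>v\<close> in \<open>V\<close>, and translating by \<open>inv v\<close> brings it
  to \<open>x\<close>, with \<open>V\<close> chosen so that the translated orbit stays inside
  \<open>Ux\<close>.\<close>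

lemma transitive_imp_locally_dense_orbit:
  assumes complete: "completely_metrizable_space T"
    and D: "countable D" "D \<subseteq> carrier G" "TG closure_of D = topspace TG"
    and transitive: "\<And>x y. \<lbrakk>x \<in> topspace T; y \<in> topspace T\<rbrakk> \<Longrightarrow> \<exists>g\<in>carrier G. y = act g x"
    and x: "x \<in> topspace T" and U: "openin TG U" "\<one> \<in> U"
  shows "x \<in> T interior_of (T closure_of ((\<lambda>g. act g x) ` U))"
proof -
  obtain V where V: "openin TG V" "\<one> \<in> V" "\<And>g h. \<lbrakk>g \<in> V; h \<in> V\<rbrakk> \<Longrightarrow> inv h \<otimes> g \<in> U"
    using open_left_quotient_nbhd[OF U] by blast
  have VG: "V \<subseteq> carrier G" using V(1) open_in_group_subset by blast
  let ?Vx = "(\<lambda>g. act g x) ` V"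
  have VxT: "?Vx \<subseteq> topspace T" using VG x act_closed by blast
  have cover: "topspace T \<subseteq> \<Union>((\<lambda>d. act d ` (T closure_of ?Vx)) ` D)"
  proof
    fix y assume y: "y \<in> topspace T"
    obtain g where g: "g \<in> carrier G" "y = act g x" using transitive[OF x y] by blast
    \<comment> \<open>The elements \<open>d\<close> with \<open>inv d \<otimes> g\<close> in
      \<open>V\<close> form an open set containing \<open>g\<close>, so one of them lies in the
      dense set \<open>D\<close>.\<close>
    have "continuous_map TG TG (\<lambda>d. inv d \<otimes> g)"
      using continuous_map_compose[OF continuous_inv continuous_right_mult[OF g(1)]]
      by (simp add: o_def)
    from openin_continuous_map_preimage[OF this V(1)]
    have op: "openin TG {d \<in> topspace TG. inv d \<otimes> g \<in> V}" .
    have "g \<in> TG closure_of D" using D(3) g(1) topspace_group by simp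
    moreover have "g \<in> {d \<in> topspace TG. inv d \<otimes> g \<in> V}" using g(1) V(2) topspace_group by simp
    ultimately obtain d where d: "d \<in> D" "inv d \<otimes> g \<in> V"
      using closure_of_meets_open[OF _ op] by blast
    have dG: "d \<in> carrier G" using d D by blast
    have "y = act d (act (inv d \<otimes> g) x)"
      using dG g x by (simp add: act_mult act_closed)
    moreover have "act (inv d \<otimes> g) x \<in> T closure_of ?Vx"
      using d(2) closure_of_subset[OF VxT] by blast
    ultimately show "y \<in> \<Union>((\<lambda>d. act d ` (T closure_of ?Vx)) ` D)" using d(1) by blast
  qed
  have "T interior_of (T closure_of ?Vx) \<noteq> {}"
  proof
    assume empty: "T interior_of (T closure_of ?Vx) = {}"
    have "T interior_of \<Union>((\<lambda>d. act d ` (T closure_of ?Vx)) ` D) = {}"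
    proof (rule Baire_category_alt)
      fix C assume "C \<in> (\<lambda>d. act d ` (T closure_of ?Vx)) ` D"
      then obtain d where d: "d \<in> carrier G" "C = act d ` (T closure_of ?Vx)" using D by blast
      note hom = homeomorphic_translation[OF d(1)]
      have "closedin T C"
        unfolding d(2) using homeomorphic_map_closedness[OF hom, of "T closure_of ?Vx"]
        by (simp add: closure_of_subset_topspace)
      moreover have "T interior_of C = {}"
        unfolding d(2) using homeomorphic_map_interior_of[OF hom, of "T closure_of ?Vx"] empty
        by (simp add: closure_of_subset_topspace)
      ultimately show "closedin T C \<and> T interior_of C = {}" by blast
    qed (use complete D in auto)
    then have "T interior_of (topspace T) = {}"
      using interior_of_mono[OF cover, of T] by blast
    then show False using x by simp
  qed
  then obtain z where z: "z \<in> T interior_of (T closure_of ?Vx)" by blast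
  then have "z \<in> T closure_of ?Vx" by (rule subsetD[OF interior_of_subset])
  from closure_of_meets_open[OF this openin_interior_of z]
  obtain v where v: "v \<in> V" "act v x \<in> T interior_of (T closure_of ?Vx)" by blast
  have vG: "v \<in> carrier G" using v VG by blast
  note hom = homeomorphic_translation[OF inv_closed[OF vG]]
  have "x = act (inv v) (act v x)" using vG x by simp
  then have "x \<in> act (inv v) ` (T interior_of (T closure_of ?Vx))" using v(2) by blast
  also have "\<dots> = T interior_of (T closure_of (act (inv v) ` ?Vx))"
    using homeomorphic_map_interior_of[OF hom, of "T closure_of ?Vx"]
      homeomorphic_map_closure_of[OF hom VxT]
    by (simp add: closure_of_subset_topspace)
  also have "\<dots> \<subseteq> T interior_of (T closure_of ((\<lambda>g. act g x) ` U))"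
  proof (intro interior_of_mono closure_of_mono subsetI)
    fix y assume "y \<in> act (inv v) ` ?Vx"
    then obtain g where g: "g \<in> V" "y = act (inv v) (act g x)" by blast
    then have "y = act (inv v \<otimes> g) x" using VG vG x by (auto simp: act_mult)
    then show "y \<in> (\<lambda>g. act g x) ` U" using V(3)[OF g(1) v(1)] by blast
  qed
  finally show ?thesis .
qed

text \<open>Allows the Baire and back-and-forth arguments to run inside a single piece of the
  partition.\<close>

lemma continuous_group_action_subtopology:
  assumes "X \<subseteq> topspace T" and "\<And>g x. \<lbrakk>g \<in> carrier G; x \<in> X\<rbrakk> \<Longrightarrow> act g x \<in> X"
  shows "continuous_group_action G TG (subtopology T X) act"
proof
  have "continuous_map (subtopology (prod_topology TG T) (topspace TG \<times> X)) T (\<lambda>(g, x). act g x)"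
    by (intro continuous_map_from_subtopology continuous_act[unfolded continuous_action_def])
  then have "continuous_map (prod_topology TG (subtopology T X)) T (\<lambda>(g, x). act g x)"
    by (simp add: prod_topology_subtopology)
  then show "continuous_action TG (subtopology T X) act"
    unfolding continuous_action_def continuous_map_in_subtopology
    using assms topspace_group by auto
qed (use assms in \<open>auto simp: topspace_group continuous_mult continuous_inv act_one act_mult\<close>)

end

section \<open>Vaught transforms of open graded subsets\<close>

lemma nonempty_open_imp_not_meagre:
  assumes "completely_metrizable_space T" "openin T W" "W \<noteq> {}"
  shows "\<not> meagre_in T W"
proof
  assume "meagre_in T W"
  then obtain \<N> where \<N>: "countable \<N>" "\<And>N. N \<in> \<N> \<Longrightarrow> nowhere_dense_in T N" "W = \<Union>\<N>"
    unfolding meagre_in_def by blast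
  have "T interior_of \<Union>((closure_of) T ` \<N>) = {}"
    using assms(1) \<N> by (intro Baire_category_alt) (auto simp: nowhere_dense_in_def)
  moreover have "W \<subseteq> \<Union>((closure_of) T ` \<N>)"
    using \<N>(2) closure_of_subset unfolding \<N>(3) nowhere_dense_in_def by fastforce
  ultimately have "W \<subseteq> {}" using interior_of_maximal[OF _ assms(2)] by metis
  then show False using assms(3) by blast
qed

lemma graded_subset_bounds:
  "\<lbrakk>graded_subset S \<phi>; x \<in> S\<rbrakk> \<Longrightarrow> 0 \<le> \<phi> x \<and> \<phi> x \<le> 1"
  unfolding graded_subset_def by (auto dest: PiE_mem)

text \<open>A nonmeagre set is nonempty, so a small value of the transform is witnessed by a group
  element. The bound \<open>r \<le> 1\<close> rules out the inserted value 1 and makes the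
  truncation of the sum harmless.\<close>

lemma vaught_delta_less_imp:
  assumes "x \<in> S" and less: "vaught_delta TG S act \<phi> J x < r" and "r \<le> 1"
  obtains h where "h \<in> topspace TG" "\<phi> (act h x) + J h < r"
proof -
  let ?A = "{r \<dotplus> s | r s. r \<in> {0..1} \<and> s \<in> {0..1} \<and>
        \<not> meagre_within TG (sublevel (topspace TG) J s) {h \<in> topspace TG. \<phi> (act h x) < r}}"
  have "Inf (insert 1 ?A) < r" using assms(1) less by (simp add: vaught_delta_def)
  then obtain a where "a \<in> insert 1 ?A" "a < r"
    using cInf_lessD[of "insert 1 ?A" r] by blast
  then obtain p s where ps: "p \<dotplus> s < r"
    "\<not> meagre_within TG (sublevel (topspace TG) J s) {h \<in> topspace TG. \<phi> (act h x) < p}"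
    using assms(3) by auto
  have "{h \<in> topspace TG. \<phi> (act h x) < p} \<inter> sublevel (topspace TG) J s \<noteq> {}"
  proof
    assume "{h \<in> topspace TG. \<phi> (act h x) < p} \<inter> sublevel (topspace TG) J s = {}"
    moreover have "meagre_in (subtopology TG (sublevel (topspace TG) J s)) {}"
      unfolding meagre_in_def by (intro exI[of _ "{}"]) auto
    ultimately show False using ps(2) unfolding meagre_within_def by simp
  qed
  then obtain h where "h \<in> topspace TG" "\<phi> (act h x) < p" "J h < s"
    unfolding sublevel_def by blast
  moreover have "p + s < r" using ps(1) assms(3) unfolding dot_plus_def by linarith
  ultimately show thesis using that by force
qed

lemma vaught_delta_le_one:
  assumes "x \<in> S"
  shows "vaught_delta TG S act \<phi> J x \<le> 1"
  using assms by (auto simp: vaught_delta_def dot_plus_def intro!: cInf_lower bdd_belowI[of _ 0])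

context continuous_group_action
begin

text \<open>For an open graded subset the category quantifier in the Vaught transform is vacuous, so that
  \<open>\<phi>\<^sup>\<Delta>\<^sup>J(x)\<close> is the truncated infimum of \<open>\<phi>(hx) + J(h)\<close> over all \<open>h\<close>.\<close>

lemma vaught_delta_le:
  assumes complete: "completely_metrizable_space TG"
    and \<phi>: "open_graded T \<phi>" and J: "open_graded TG J"
    and x: "x \<in> topspace T" and h: "h \<in> carrier G"
  shows "vaught_delta TG (topspace T) act \<phi> J x \<le> \<phi> (act h x) + J h"
proof (cases "\<phi> (act h x) + J h < 1")
  case False
  then show ?thesis using vaught_delta_le_one[OF x, of TG act \<phi> J] by linarith
next
  case True
  have \<phi>0: "0 \<le> \<phi> (act h x)" and J0: "0 \<le> J h"
    using graded_subset_bounds \<phi> J h x act_closed topspace_group unfolding open_graded_def by metis+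
  show ?thesis
  proof (rule field_le_epsilon)
    fix e :: real assume "e > 0"
    \<comment> \<open>The bound \<open>e / 2\<close> controls the total overshoot; the other two
      keep \<open>?r\<close> and \<open>?s\<close> in the unit interval, where the parameters of the
      transform range.\<close>
    define \<delta> where "\<delta> = min (e / 2) (min (1 - \<phi> (act h x)) (1 - J h))"
    have \<delta>: "\<delta> > 0" "\<delta> \<le> e / 2" "\<phi> (act h x) + \<delta> \<le> 1" "J h + \<delta> \<le> 1"
      using \<open>e > 0\<close> True \<phi>0 J0 unfolding \<delta>_def by linarith+
    let ?r = "\<phi> (act h x) + \<delta>" and ?s = "J h + \<delta>"
    let ?J = "sublevel (topspace TG) J ?s" and ?W = "{h \<in> topspace TG. \<phi> (act h x) < ?r}"
    have opJ: "openin TG ?J" using J unfolding open_graded_def by blast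
    have "openin T (sublevel (topspace T) \<phi> ?r)" using \<phi> unfolding open_graded_def by blast
    from openin_continuous_map_preimage[OF continuous_orbit_map[OF x] this]
    have "openin TG {h \<in> topspace TG. act h x \<in> sublevel (topspace T) \<phi> ?r}" .
    also have "{h \<in> topspace TG. act h x \<in> sublevel (topspace T) \<phi> ?r} = ?W"
      using x act_closed topspace_group by (auto simp: sublevel_def)
    finally have "openin (subtopology TG ?J) (?W \<inter> ?J)"
      by (simp add: openin_subtopology_Int)
    moreover have "h \<in> ?W \<inter> ?J" using h \<delta> by (simp add: topspace_group sublevel_def)
    moreover have "completely_metrizable_space (subtopology TG ?J)"
      by (rule completely_metrizable_space_openin[OF complete opJ])
    ultimately have "\<not> meagre_within TG ?J ?W"
      unfolding meagre_within_def using nonempty_open_imp_not_meagre by blast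
    then have "Inf (insert 1 {r \<dotplus> s | r s. r \<in> {0..1} \<and> s \<in> {0..1} \<and>
        \<not> meagre_within TG (sublevel (topspace TG) J s) {h \<in> topspace TG. \<phi> (act h x) < r}}) \<le> ?r \<dotplus> ?s"
      using \<delta> \<phi>0 J0
      by (intro cInf_lower bdd_belowI[of _ 0]) (fastforce simp: dot_plus_def)+
    then have "vaught_delta TG (topspace T) act \<phi> J x \<le> ?r \<dotplus> ?s"
      using x by (simp add: vaught_delta_def)
    also have "\<dots> \<le> \<phi> (act h x) + J h + e" using \<delta> unfolding dot_plus_def by linarith
    finally show "vaught_delta TG (topspace T) act \<phi> J x \<le> \<phi> (act h x) + J h + e" .
  qed
qed

text \<open>The point \<open>act h x\<close> is reached from \<open>act g x\<close> by
  \<open>h \<otimes> inv g\<close>, whose cost exceeds that of \<open>h\<close> by at most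
  \<open>H g\<close>, by subadditivity and symmetry of \<open>H\<close>.\<close>

lemma vaught_delta_invariant:
  assumes complete: "completely_metrizable_space TG"
    and \<phi>: "open_graded T \<phi>" and H: "open_graded TG H" "graded_subgroup G H"
  shows "graded_invariant G (topspace T) act H (vaught_delta TG (topspace T) act \<phi> H)"
  unfolding graded_invariant_def dot_plus_def
proof (intro ballI min.boundedI)
  let ?\<psi> = "vaught_delta TG (topspace T) act \<phi> H"
  fix g x assume g: "g \<in> carrier G" and x: "x \<in> topspace T"
  have gx: "act g x \<in> topspace T" using g x act_closed by blast
  show le1: "?\<psi> (act g x) \<le> 1" by (rule vaught_delta_le_one[OF gx])
  show "?\<psi> (act g x) \<le> ?\<psi> x + H g"
  proof (rule ccontr)
    assume "\<not> ?\<psi> (act g x) \<le> ?\<psi> x + H g"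
    then have "?\<psi> x < ?\<psi> (act g x) - H g" by simp
    moreover have "?\<psi> (act g x) - H g \<le> 1"
      using le1 graded_subset_bounds H(2) g unfolding graded_subgroup_def by fastforce
    ultimately obtain h where h: "h \<in> carrier G" "\<phi> (act h x) + H h < ?\<psi> (act g x) - H g"
      using vaught_delta_less_imp[OF x] topspace_group by metis
    have "?\<psi> (act g x) \<le> \<phi> (act (h \<otimes> inv g) (act g x)) + H (h \<otimes> inv g)"
      using vaught_delta_le[OF complete \<phi> H(1) gx] h g by blast
    also have "act (h \<otimes> inv g) (act g x) = act h x"
      using g h(1) x gx by (simp add: act_mult)
    also have "H (h \<otimes> inv g) \<le> H h + H g"
      using H(2) g h(1) unfolding graded_subgroup_def by (metis inv_closed)
    finally show False using h(2) by simp
  qed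
qed

text \<open>Since \<open>H\<close> is symmetric, invariance applied to \<open>inv g\<close> at
  \<open>act g x\<close> also bounds the drop of \<open>\<phi>\<close>. Through complements, types
  record lower bounds of invariant functions as well as upper ones.\<close>

lemma graded_invariant_complement:
  assumes "graded_subset (topspace T) \<phi>" "graded_subgroup G H" "graded_invariant G (topspace T) act H \<phi>"
  shows "graded_invariant G (topspace T) act H (\<lambda>x\<in>topspace T. 1 - \<phi> x)"
  unfolding graded_invariant_def
proof (intro ballI)
  fix g x assume g: "g \<in> carrier G" and x: "x \<in> topspace T"
  have gx: "act g x \<in> topspace T" using g x act_closed by blast
  have "\<phi> (act (inv g) (act g x)) \<le> \<phi> (act g x) \<dotplus> H (inv g)"
    using assms(3) g gx unfolding graded_invariant_def by blast
  moreover have "H (inv g) = H g" using assms(2) g unfolding graded_subgroup_def by metis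
  ultimately have "\<phi> x \<le> \<phi> (act g x) + H g" using g x unfolding dot_plus_def by simp
  then show "(\<lambda>x\<in>topspace T. 1 - \<phi> x) (act g x) \<le> (\<lambda>x\<in>topspace T. 1 - \<phi> x) x \<dotplus> H g"
    using graded_subset_bounds[OF assms(1) gx] x gx unfolding dot_plus_def by simp
qed

end

section \<open>Graded bases and the canonical partition\<close>

lemma graded_basisE:
  assumes "graded_basis T \<F>" "openin T W" "x \<in> W"
  obtains \<phi> r where "\<phi> \<in> \<F>" "r \<in> \<rat>" "x \<in> sublevel (topspace T) \<phi> r" "sublevel (topspace T) \<phi> r \<subseteq> W"
proof -
  have "(arbitrary union_of (\<lambda>U. U \<in> rational_sublevels (topspace T) \<F>)) W"
    using assms unfolding graded_basis_def by metis
  then obtain \<U> where \<U>: "\<U> \<subseteq> rational_sublevels (topspace T) \<F>" "\<Union>\<U> = W"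
    unfolding union_of_def arbitrary_def by auto
  then obtain U where "U \<in> rational_sublevels (topspace T) \<F>" "x \<in> U" "U \<subseteq> W"
    using assms(3) by blast
  then show thesis using that unfolding rational_sublevels_def by blast
qed

lemma graded_subgroup_nonneg: "\<lbrakk>graded_subgroup G H; g \<in> carrier G\<rbrakk> \<Longrightarrow> 0 \<le> H g"
  unfolding graded_subgroup_def using graded_subset_bounds[of "carrier G" H g] by simp

lemma in_canonical_set:
  "x \<in> canonical_set G S act A t \<longleftrightarrow> x \<in> S \<and> (\<forall>j. t j \<longleftrightarrow> x \<in> saturation G act (A j))"
  unfolding canonical_set_def by blast

context continuous_group_action
begin

lemma openin_saturation:
  assumes "openin T W" shows "openin T (saturation G act W)"
  unfolding saturation_def
  using assms homeomorphic_map_openness[OF homeomorphic_translation openin_subset]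
  by (intro openin_Union) auto

lemma act_in_saturation:
  assumes "W \<subseteq> topspace T" "g \<in> carrier G" "x \<in> saturation G act W"
  shows "act g x \<in> saturation G act W"
proof -
  obtain h w where h: "h \<in> carrier G" "w \<in> W" "x = act h w"
    using assms(3) unfolding saturation_def by blast
  then have "act g x = act (g \<otimes> h) w" using assms by (auto simp: act_mult)
  then show ?thesis unfolding saturation_def using h assms(2) by blast
qed

lemma act_in_saturation_iff:
  assumes "W \<subseteq> topspace T" "g \<in> carrier G" "x \<in> topspace T"
  shows "act g x \<in> saturation G act W \<longleftrightarrow> x \<in> saturation G act W"
  using act_in_saturation[OF assms(1,2), of x]
    act_in_saturation[OF assms(1) inv_closed[OF assms(2)], of "act g x"] assms(2,3) by auto

lemma canonical_set_invariant:
  assumes "\<And>j. A j \<subseteq> topspace T" "g \<in> carrier G" "x \<in> canonical_set G (topspace T) act A t"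
  shows "act g x \<in> canonical_set G (topspace T) act A t"
  using assms act_closed act_in_saturation_iff[OF assms(1,2)] by (simp add: in_canonical_set)

text \<open>Each of the countably many conditions defines an open or a closed set, and closed sets
  are of this kind in a metrizable space. In a completely metrizable space the piece is then
  completely metrizable too.\<close>

lemma gdelta_in_canonical_set:
  assumes "metrizable_space T" and A: "\<And>j. openin T (A j)"
  shows "gdelta_in T (canonical_set G (topspace T) act A t)"
proof -
  define C where "C j = (if t j then saturation G act (A j) else topspace T - saturation G act (A j))" for j
  have "gdelta_in T (C j)" for j
    unfolding C_def using openin_saturation[OF A] closed_imp_gdelta_in[OF assms(1)]
    by (simp add: open_imp_gdelta_in closedin_diff)
  then have "gdelta_in T (topspace T \<inter> \<Inter>(range C))"
    by (intro gdelta_in_Int gdelta_in_Inter) auto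
  also have "topspace T \<inter> \<Inter>(range C) = canonical_set G (topspace T) act A t"
  proof (rule Set.set_eqI)
    fix x
    have "x \<in> C j \<longleftrightarrow> (t j \<longleftrightarrow> x \<in> saturation G act (A j))" if "x \<in> topspace T" for j
      using that by (simp add: C_def)
    then show "x \<in> topspace T \<inter> \<Inter>(range C) \<longleftrightarrow> x \<in> canonical_set G (topspace T) act A t"
      unfolding in_canonical_set by blast
  qed
  finally show ?thesis .
qed

text \<open>Points of one piece lie in the same saturations of basic sets: a basic neighbourhood of
  \<open>y\<close> has \<open>y\<close>, hence also \<open>x\<close>, in its saturation.\<close>

lemma canonical_set_dense_orbits:
  assumes A: "range A = {sublevel (topspace T) \<phi> r | \<phi> r. \<phi> \<in> \<B> \<and> r \<in> \<rat>}"
    and "graded_basis T \<B>" and X: "X = canonical_set G (topspace T) act A t"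
    and "x \<in> X" "y \<in> X" and W: "openin T W" "y \<in> W"
  obtains g where "g \<in> carrier G" "act g x \<in> W"
proof -
  obtain \<phi> r where \<phi>: "\<phi> \<in> \<B>" "r \<in> \<rat>" "y \<in> sublevel (topspace T) \<phi> r" "sublevel (topspace T) \<phi> r \<subseteq> W"
    using graded_basisE[OF assms(2) W] by blast
  then have "sublevel (topspace T) \<phi> r \<in> range A" unfolding A by blast
  then obtain j where j: "A j = sublevel (topspace T) \<phi> r" by auto
  have yT: "y \<in> topspace T" and xT: "x \<in> topspace T" using assms(4,5) unfolding X in_canonical_set by auto
  have "act \<one> y \<in> saturation G act (A j)"
    unfolding saturation_def j using \<phi>(3) by blast
  then have "y \<in> saturation G act (A j)" using act_one yT by simp
  then have "t j" using assms(5) unfolding X in_canonical_set by blast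
  then have "x \<in> saturation G act (A j)" using assms(4) unfolding X in_canonical_set by blast
  then obtain h w where h: "h \<in> carrier G" "w \<in> A j" "x = act h w" unfolding saturation_def by blast
  have "w \<in> topspace T" using h(2) unfolding j sublevel_def by blast
  then have "act (inv h) x = w" using h by simp
  then show thesis using that[of "inv h"] h(1,2) \<phi>(4) j by blast
qed

end

section \<open>Nice bases, types of points and principality\<close>

locale nice_action = continuous_group_action G TG T act
  for G (structure) and TG :: "'a topology" and T :: "'x topology" and act +
  fixes \<R> :: "('a \<Rightarrow> real) set" and \<B> :: "('x \<Rightarrow> real) set"
  assumes complete_group: "completely_metrizable_space TG"
    and group_basis: "graded_basis TG \<R>"
    and group_basis_coset: "\<rho> \<in> \<R> \<Longrightarrow> \<exists>H\<in>\<R>. graded_subgroup G H \<and> (\<exists>g\<in>carrier G. \<rho> = graded_coset G H g)"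
    and basis: "graded_basis T \<B>"
    and complement: "\<phi> \<in> \<B> \<Longrightarrow> (\<lambda>x\<in>topspace T. 1 - \<phi> x) \<in> \<B>"
    and difference: "\<lbrakk>\<phi> \<in> \<B>; \<psi> \<in> \<B>\<rbrakk> \<Longrightarrow> (\<lambda>x\<in>topspace T. \<phi> x \<dotminus> \<psi> x) \<in> \<B>"
    and scaling: "\<lbrakk>\<phi> \<in> \<B>; q > 0\<rbrakk> \<Longrightarrow> (\<lambda>x\<in>topspace T. dot_times q (\<phi> x)) \<in> \<B>"
    and vaught_delta: "\<lbrakk>\<phi> \<in> \<B>; \<rho> \<in> \<R>\<rbrakk> \<Longrightarrow> vaught_delta TG (topspace T) act \<phi> \<rho> \<in> \<B>"
begin

lemma basis_open: "\<phi> \<in> \<B> \<Longrightarrow> open_graded T \<phi>"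
  using basis unfolding graded_basis_def by blast

lemma basis_graded: "\<phi> \<in> \<B> \<Longrightarrow> graded_subset (topspace T) \<phi>"
  using basis_open unfolding open_graded_def by blast

lemma basis_nonneg: "\<lbrakk>\<phi> \<in> \<B>; x \<in> topspace T\<rbrakk> \<Longrightarrow> 0 \<le> \<phi> x"
  using graded_subset_bounds[OF basis_graded] by simp

lemma group_basis_open: "\<rho> \<in> \<R> \<Longrightarrow> open_graded TG \<rho>"
  using group_basis unfolding graded_basis_def by blast

text \<open>Subtracting a rational constant between \<open>\<phi> x\<close> and the level makes the
  function vanish at \<open>x\<close>. This normalization survives rescaling and makes the Vaught
  transform over a graded subgroup vanish at \<open>x\<close> as well.\<close>

lemma basic_nbhd:
  assumes "openin T W" "x \<in> W"
  obtains \<phi> s where "\<phi> \<in> \<B>" "\<phi> x = 0" "s > 0" "sublevel (topspace T) \<phi> s \<subseteq> W"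
proof -
  have xT: "x \<in> topspace T" using assms openin_subset by blast
  obtain \<phi> r where \<phi>: "\<phi> \<in> \<B>" "x \<in> sublevel (topspace T) \<phi> r" "sublevel (topspace T) \<phi> r \<subseteq> W"
    using graded_basisE[OF basis assms] by blast
  have \<phi>x: "0 \<le> \<phi> x" "\<phi> x < r" using \<phi>(2) basis_nonneg[OF \<phi>(1) xT] unfolding sublevel_def by auto
  then obtain q where q: "\<phi> x < of_rat q" "of_rat q < r" using of_rat_dense[of "\<phi> x" r] by blast
  then have "q > 0" using \<phi>x(1) by (metis of_rat_0 of_rat_less le_less_trans)
  \<comment> \<open>Constants are built inside the basis: a function minus itself is 0, its
    complement is 1, and the multiple by \<open>q\<close> is the minimum of \<open>q\<close> and 1,
    which is still at least \<open>\<phi> x\<close>.\<close>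
  define zero where "zero = (\<lambda>x\<in>topspace T. \<phi> x \<dotminus> \<phi> x)"
  define one where "one = (\<lambda>x\<in>topspace T. 1 - zero x)"
  define c where "c = (\<lambda>x\<in>topspace T. dot_times q (one x))"
  define \<psi> where "\<psi> = (\<lambda>x\<in>topspace T. \<phi> x \<dotminus> c x)"
  have "\<psi> \<in> \<B>"
    unfolding \<psi>_def c_def one_def zero_def
    using \<phi>(1) \<open>q > 0\<close> by (intro difference scaling complement)
  moreover have c: "c y = min (of_rat q) 1" if "y \<in> topspace T" for y
    using that unfolding c_def one_def zero_def by (simp add: dot_minus_def dot_times_def)
  then have "\<psi> x = 0"
    using xT q(1) graded_subset_bounds[OF basis_graded[OF \<phi>(1)] xT]
    unfolding \<psi>_def by (simp add: dot_minus_def)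
  moreover have "r - of_rat q > 0" using q(2) by simp
  moreover have "sublevel (topspace T) \<psi> (r - of_rat q) \<subseteq> W"
    using \<phi>(3) c unfolding \<psi>_def sublevel_def by (force simp: dot_minus_def)
  ultimately show thesis using that by blast
qed

text \<open>The basis supplies a coset of some \<open>H\<close> by \<open>g\<close> rather than
  \<open>H\<close> itself. That \<open>\<one>\<close> lies below level \<open>r\<close> of the coset
  means \<open>H (inv g) < r\<close>, and subadditivity leaves the margin
  \<open>r - H (inv g)\<close> for \<open>H\<close>.\<close>

lemma subgroup_nbhd:
  assumes "openin TG U" "\<one> \<in> U"
  obtains H \<epsilon> where "H \<in> \<R>" "graded_subgroup G H" "\<epsilon> > 0" "sublevel (carrier G) H \<epsilon> \<subseteq> U"
proof -
  obtain \<rho> r where \<rho>: "\<rho> \<in> \<R>" "\<one> \<in> sublevel (carrier G) \<rho> r" "sublevel (carrier G) \<rho> r \<subseteq> U"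
    using graded_basisE[OF group_basis assms] topspace_group by metis
  obtain H g where H: "H \<in> \<R>" "graded_subgroup G H" "g \<in> carrier G" "\<rho> = graded_coset G H g"
    using group_basis_coset[OF \<rho>(1)] by blast
  have "r - H (inv g) > 0"
    using \<rho>(2) H(3,4) unfolding sublevel_def graded_coset_def by simp
  moreover have "sublevel (carrier G) H (r - H (inv g)) \<subseteq> sublevel (carrier G) \<rho> r"
  proof
    fix h assume h: "h \<in> sublevel (carrier G) H (r - H (inv g))"
    then have hG: "h \<in> carrier G" unfolding sublevel_def by blast
    have "H (h \<otimes> inv g) \<le> H h + H (inv g)"
      using H(2) hG H(3) unfolding graded_subgroup_def by blast
    then show "h \<in> sublevel (carrier G) \<rho> r"
      using h hG H(4) unfolding sublevel_def graded_coset_def by simp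
  qed
  ultimately show thesis using that H(1,2) \<rho>(3) by blast
qed

text \<open>Maximality comes from complements. If \<open>y\<close> realizes a larger family, then
  invariant basic functions are no larger at \<open>y\<close> than at \<open>x\<close>; applied to
  \<open>1 - \<phi>\<close> this shows that \<open>\<phi>\<close> is no smaller at \<open>y\<close>.
  So every set of the larger family contains \<open>x\<close> already.\<close>

lemma point_type:
  assumes H: "graded_subgroup G H" and X: "X \<subseteq> topspace T" "x \<in> X"
  shows "is_H_type G (topspace T) act \<B> H X
    {sublevel (topspace T) \<phi> r | \<phi> r. \<phi> \<in> \<B> \<and> graded_invariant G (topspace T) act H \<phi> \<and> \<phi> x < r}"
    (is "is_H_type _ _ _ _ _ _ ?F")
  unfolding is_H_type_def
proof (intro conjI allI impI)
  have xT: "x \<in> topspace T" using X by blast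
  have "x \<in> X \<inter> \<Inter>?F" using X by (auto simp: sublevel_def)
  then show "type_family G (topspace T) act \<B> H X ?F" unfolding type_family_def by blast
  fix F' assume F': "type_family G (topspace T) act \<B> H X F' \<and> ?F \<subseteq> F'"
  then obtain y where y: "y \<in> X" "y \<in> \<Inter>F'" unfolding type_family_def by blast
  have yT: "y \<in> topspace T" using X y by blast
  have less: "\<phi> y < r" if "\<phi> \<in> \<B>" "graded_invariant G (topspace T) act H \<phi>" "\<phi> x < r" for \<phi> r
  proof -
    have "sublevel (topspace T) \<phi> r \<in> F'" using that F' by blast
    then have "y \<in> sublevel (topspace T) \<phi> r" using y(2) by blast
    then show ?thesis unfolding sublevel_def by blast
  qed
  have "\<phi> x \<le> \<phi> y" if \<phi>: "\<phi> \<in> \<B>" "graded_invariant G (topspace T) act H \<phi>" for \<phi>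
  proof (rule ccontr)
    assume "\<not> \<phi> x \<le> \<phi> y"
    then have "(\<lambda>x\<in>topspace T. 1 - \<phi> x) x < 1 - \<phi> y" using xT by simp
    from less[OF complement[OF \<phi>(1)] graded_invariant_complement[OF basis_graded[OF \<phi>(1)] H \<phi>(2)] this]
    show False using yT by simp
  qed
  note ge = this
  have "U \<in> ?F" if "U \<in> F'" for U
  proof -
    have "F' \<subseteq> {sublevel (topspace T) \<phi> r | \<phi> r. \<phi> \<in> \<B> \<and> graded_invariant G (topspace T) act H \<phi>}"
      using F' unfolding type_family_def by (elim conjE)
    from subsetD[OF this that]
    obtain \<phi> r where \<phi>: "\<phi> \<in> \<B>" "graded_invariant G (topspace T) act H \<phi>" "U = sublevel (topspace T) \<phi> r"
      by blast
    have "y \<in> sublevel (topspace T) \<phi> r" using y(2) that unfolding \<phi>(3) by blast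
    then have "\<phi> y < r" unfolding sublevel_def by blast
    then have "\<phi> x < r" using ge[OF \<phi>(1,2)] by linarith
    then show ?thesis using \<phi> by blast
  qed
  then show "F' = ?F" using F' by blast
qed

text \<open>The set isolating the type of \<open>x\<close> up to \<open>\<epsilon>\<close> is the
  required neighbourhood. For \<open>y\<close> in it, a transform vanishing at \<open>y\<close> must
  be small at \<open>x\<close>, and a witness for this small value is an element of \<open>U\<close>
  that moves \<open>x\<close> close to \<open>y\<close>.\<close>

lemma principal_types_imp_locally_dense:
  assumes X: "X \<subseteq> topspace T" and inv: "\<And>g x. \<lbrakk>g \<in> carrier G; x \<in> X\<rbrakk> \<Longrightarrow> act g x \<in> X"
    and principal: "\<And>H \<F>. \<lbrakk>H \<in> \<R>; graded_subgroup G H; is_H_type G (topspace T) act \<B> H X \<F>\<rbrakk>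
          \<Longrightarrow> principal_H_type G (topspace T) act \<B> H X \<F>"
    and x: "x \<in> X" and U: "openin TG U" "\<one> \<in> U"
  shows "x \<in> subtopology T X interior_of (subtopology T X closure_of ((\<lambda>g. act g x) ` U))"
proof -
  have xT: "x \<in> topspace T" using X x by blast
  obtain H \<epsilon>\<^sub>0 where H: "H \<in> \<R>" "graded_subgroup G H" "\<epsilon>\<^sub>0 > 0" "sublevel (carrier G) H \<epsilon>\<^sub>0 \<subseteq> U"
    using subgroup_nbhd[OF U] by blast
  have H1: "H \<one> = 0" using H(2) unfolding graded_subgroup_def by blast
  \<comment> \<open>Twice \<open>\<epsilon>\<close> is at most 1, so that a value of the transform
    below it has a witness, and at most \<open>\<epsilon>\<^sub>0\<close>, so that the witness lies
    in \<open>U\<close>.\<close>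
  define \<epsilon> where "\<epsilon> = min \<epsilon>\<^sub>0 1 / 2"
  have \<epsilon>: "\<epsilon> > 0" "2 * \<epsilon> \<le> 1" "2 * \<epsilon> \<le> \<epsilon>\<^sub>0" using H(3) unfolding \<epsilon>_def by auto
  define F where "F = {sublevel (topspace T) \<phi> r | \<phi> r. \<phi> \<in> \<B> \<and> graded_invariant G (topspace T) act H \<phi> \<and> \<phi> x < r}"
  have "principal_H_type G (topspace T) act \<B> H X F"
    unfolding F_def by (rule principal[OF H(1,2) point_type[OF H(2) X x]])
  then obtain \<phi> r where \<phi>: "\<phi> \<in> \<B>" "sublevel (topspace T) \<phi> r \<in> F"
    "\<And>\<psi> t. \<lbrakk>\<psi> \<in> \<B>; graded_invariant G (topspace T) act H \<psi>; sublevel (topspace T) \<psi> t \<in> F\<rbrakk>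
       \<Longrightarrow> sublevel (topspace T) \<phi> r \<inter> X \<subseteq> sublevel (topspace T) \<psi> (t + \<epsilon>)"
    unfolding principal_H_type_def using \<epsilon>(1) by meson
  let ?W = "sublevel (topspace T) \<phi> r \<inter> X"
  have "openin (subtopology T X) ?W"
    using basis_open[OF \<phi>(1)] unfolding open_graded_def by (simp add: openin_subtopology_Int)
  \<comment> \<open>Membership in \<open>F\<close> is a property of the set, so it may come from
    another function and level than \<open>\<phi>\<close> and \<open>r\<close>.\<close>
  moreover have "x \<in> ?W"
  proof -
    obtain \<phi>' r' where "\<phi>' x < r'" "sublevel (topspace T) \<phi> r = sublevel (topspace T) \<phi>' r'"
      using \<phi>(2) unfolding F_def mem_Collect_eq by (elim exE conjE)
    then show ?thesis using x xT by (simp add: sublevel_def[of _ \<phi>'])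
  qed
  moreover have "?W \<subseteq> subtopology T X closure_of ((\<lambda>g. act g x) ` U)"
  proof
    fix y assume y: "y \<in> ?W"
    then have yT: "y \<in> topspace T" using X by blast
    have "\<exists>z. z \<in> (\<lambda>g. act g x) ` U \<and> z \<in> N" if N: "y \<in> N" "openin (subtopology T X) N" for N
    proof -
      obtain N' where N': "openin T N'" "N = N' \<inter> X" using N(2) unfolding openin_subtopology by blast
      obtain \<phi>\<^sub>1 s where \<phi>\<^sub>1: "\<phi>\<^sub>1 \<in> \<B>" "\<phi>\<^sub>1 y = 0" "s > 0" "sublevel (topspace T) \<phi>\<^sub>1 s \<subseteq> N'"
        using basic_nbhd[OF N'(1)] N(1) N'(2) by blast
      \<comment> \<open>After scaling by \<open>q\<close>, a value below 1 forces
        \<open>\<phi>\<^sub>1\<close> below \<open>s\<close>.\<close>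
      obtain q where q: "1 / s < of_rat q" using of_rat_dense[of "1 / s" "1 / s + 1"] by auto
      have "q > 0" using q \<phi>\<^sub>1(3)
        by (metis divide_pos_pos less_trans of_rat_0 of_rat_less zero_less_one)
      define \<phi>\<^sub>2 where "\<phi>\<^sub>2 = (\<lambda>x\<in>topspace T. dot_times q (\<phi>\<^sub>1 x))"
      have \<phi>\<^sub>2: "\<phi>\<^sub>2 \<in> \<B>" unfolding \<phi>\<^sub>2_def by (rule scaling[OF \<phi>\<^sub>1(1) \<open>q > 0\<close>])
      define \<psi> where "\<psi> = vaught_delta TG (topspace T) act \<phi>\<^sub>2 H"
      have \<psi>: "\<psi> \<in> \<B>" unfolding \<psi>_def by (rule vaught_delta[OF \<phi>\<^sub>2 H(1)])
      have \<psi>_inv: "graded_invariant G (topspace T) act H \<psi>"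
        unfolding \<psi>_def
        by (rule vaught_delta_invariant[OF complete_group basis_open[OF \<phi>\<^sub>2] group_basis_open[OF H(1)] H(2)])
      have "\<psi> y \<le> \<phi>\<^sub>2 (act \<one> y) + H \<one>"
        unfolding \<psi>_def
        by (rule vaught_delta_le[OF complete_group basis_open[OF \<phi>\<^sub>2] group_basis_open[OF H(1)] yT one_closed])
      then have \<psi>y: "\<psi> y \<le> 0" using yT \<phi>\<^sub>1(2) H1 unfolding \<phi>\<^sub>2_def by (simp add: act_one dot_times_def)
      have "\<psi> x \<le> \<epsilon>"
      proof (rule ccontr)
        assume "\<not> \<psi> x \<le> \<epsilon>"
        \<comment> \<open>If \<open>\<psi> x\<close> exceeded \<open>\<epsilon>\<close>, the type
          would contain the sublevel set of the complement at \<open>1 - \<epsilon>\<close>.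
          Principality then puts the complement below 1 at \<open>y\<close>, although
          \<open>\<psi>\<close> vanishes there.\<close>
        let ?\<chi> = "\<lambda>x\<in>topspace T. 1 - \<psi> x"
        have \<chi>: "?\<chi> \<in> \<B>" "graded_invariant G (topspace T) act H ?\<chi>"
          using complement[OF \<psi>] graded_invariant_complement[OF basis_graded[OF \<psi>] H(2) \<psi>_inv] by auto
        have "?\<chi> x < 1 - \<epsilon>" using \<open>\<not> \<psi> x \<le> \<epsilon>\<close> xT by simp
        then have "sublevel (topspace T) ?\<chi> (1 - \<epsilon>) \<in> F" unfolding F_def using \<chi> by blast
        from \<phi>(3)[OF \<chi> this] have "y \<in> sublevel (topspace T) ?\<chi> (1 - \<epsilon> + \<epsilon>)" using y by blast
        then show False using yT \<psi>y unfolding sublevel_def by simp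
      qed
      then have "\<psi> x < 2 * \<epsilon>" using \<epsilon>(1) by linarith
      then obtain h where h: "h \<in> carrier G" "\<phi>\<^sub>2 (act h x) + H h < 2 * \<epsilon>"
        using vaught_delta_less_imp[OF xT _ \<epsilon>(2), of TG act \<phi>\<^sub>2 H] topspace_group
        unfolding \<psi>_def by metis
      have hx: "act h x \<in> topspace T" using h xT act_closed by blast
      have "H h < \<epsilon>\<^sub>0" using h(2) basis_nonneg[OF \<phi>\<^sub>2 hx] \<epsilon>(3) by linarith
      then have "h \<in> U" using H(4) h(1) unfolding sublevel_def by blast
      have "\<phi>\<^sub>2 (act h x) < 1" using h(2) graded_subgroup_nonneg[OF H(2) h(1)] \<epsilon>(2) by linarith
      then have lt: "of_rat q * \<phi>\<^sub>1 (act h x) < 1" using hx unfolding \<phi>\<^sub>2_def by (simp add: dot_times_def)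
      have "\<phi>\<^sub>1 (act h x) < s"
      proof (rule ccontr)
        assume "\<not> \<phi>\<^sub>1 (act h x) < s"
        then have "1 / s * s \<le> of_rat q * \<phi>\<^sub>1 (act h x)"
          using q \<phi>\<^sub>1(3) \<open>q > 0\<close> by (intro mult_mono) auto
        then show False using lt \<phi>\<^sub>1(3) by simp
      qed
      then have "act h x \<in> N'" using \<phi>\<^sub>1(4) hx unfolding sublevel_def by blast
      then have "act h x \<in> N" using inv[OF h(1) x] N'(2) by blast
      then show ?thesis using \<open>h \<in> U\<close> by blast
    qed
    then show "y \<in> subtopology T X closure_of ((\<lambda>g. act g x) ` U)"
      unfolding in_closure_of using y yT by auto
  qed
  ultimately show ?thesis
    using interior_of_maximal[of ?W] by blast
qed

text \<open>Let \<open>x\<close> realize the type. If a transform centred at \<open>x\<close> is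
  small at \<open>y\<close>, then \<open>y = act (inv h) (act g x)\<close> with \<open>H h\<close>
  and \<open>H g\<close> both below \<open>\<epsilon> / 2\<close>, so an invariant function grows by
  less than \<open>\<epsilon>\<close> from \<open>x\<close> to \<open>y\<close>.\<close>

lemma open_orbits_imp_principal_type:
  assumes X: "X \<subseteq> topspace T" and inv: "\<And>g x. \<lbrakk>g \<in> carrier G; x \<in> X\<rbrakk> \<Longrightarrow> act g x \<in> X"
    and "open": "\<And>x U. \<lbrakk>x \<in> X; openin TG U; \<one> \<in> U\<rbrakk> \<Longrightarrow> x \<in> subtopology T X interior_of ((\<lambda>g. act g x) ` U)"
    and H: "H \<in> \<R>" "graded_subgroup G H"
    and type: "is_H_type G (topspace T) act \<B> H X \<F>"
  shows "principal_H_type G (topspace T) act \<B> H X \<F>"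
  unfolding principal_H_type_def
proof (intro allI impI)
  fix \<epsilon> :: real assume "\<epsilon> > 0"
  obtain x where x: "x \<in> X" "x \<in> \<Inter>\<F>" using type unfolding is_H_type_def type_family_def by blast
  have xT: "x \<in> topspace T" using X x by blast
  have H1: "H \<one> = 0" using H(2) unfolding graded_subgroup_def by blast
  let ?U = "sublevel (topspace TG) H (\<epsilon> / 2)"
  have "openin TG ?U" using group_basis_open[OF H(1)] unfolding open_graded_def by blast
  moreover have "\<one> \<in> ?U" using H1 \<open>\<epsilon> > 0\<close> by (simp add: sublevel_def topspace_group)
  ultimately have "x \<in> subtopology T X interior_of ((\<lambda>g. act g x) ` ?U)" using "open" x(1) by blast
  then obtain N where N: "openin (subtopology T X) N" "x \<in> N" "N \<subseteq> (\<lambda>g. act g x) ` ?U"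
    unfolding interior_of_def by blast
  then obtain N' where N': "openin T N'" "N = N' \<inter> X" unfolding openin_subtopology by blast
  obtain \<phi>\<^sub>1 s where \<phi>\<^sub>1: "\<phi>\<^sub>1 \<in> \<B>" "\<phi>\<^sub>1 x = 0" "s > 0" "sublevel (topspace T) \<phi>\<^sub>1 s \<subseteq> N'"
    using basic_nbhd[OF N'(1)] N(2) N'(2) by blast
  define \<phi> where "\<phi> = vaught_delta TG (topspace T) act \<phi>\<^sub>1 H"
  \<comment> \<open>The bound \<open>s\<close> sends the witness into \<open>N'\<close>,
    \<open>\<epsilon> / 2\<close> limits its cost, and 1 is what extracting a witness from the
    transform requires.\<close>
  define r where "r = min s (min (\<epsilon> / 2) 1)"
  have r: "r > 0" "r \<le> s" "r \<le> \<epsilon> / 2" "r \<le> 1" using \<phi>\<^sub>1(3) \<open>\<epsilon> > 0\<close> unfolding r_def by linarith+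
  have \<phi>: "\<phi> \<in> \<B>" unfolding \<phi>_def by (rule vaught_delta[OF \<phi>\<^sub>1(1) H(1)])
  have \<phi>_inv: "graded_invariant G (topspace T) act H \<phi>"
    unfolding \<phi>_def
    by (rule vaught_delta_invariant[OF complete_group basis_open[OF \<phi>\<^sub>1(1)] group_basis_open[OF H(1)] H(2)])
  have "\<phi> x \<le> \<phi>\<^sub>1 (act \<one> x) + H \<one>"
    unfolding \<phi>_def
    by (rule vaught_delta_le[OF complete_group basis_open[OF \<phi>\<^sub>1(1)] group_basis_open[OF H(1)] xT one_closed])
  then have "\<phi> x < r" using xT \<phi>\<^sub>1(2) H1 r(1) by (simp add: act_one)
  then have "x \<in> sublevel (topspace T) \<phi> r" using xT unfolding sublevel_def by blast
  then have nonempty: "X \<inter> \<Inter>(insert (sublevel (topspace T) \<phi> r) \<F>) \<noteq> {}" using x by blast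
  let ?inv = "{sublevel (topspace T) \<phi> r | \<phi> r. \<phi> \<in> \<B> \<and> graded_invariant G (topspace T) act H \<phi>}"
  have "sublevel (topspace T) \<phi> r \<in> ?inv" using \<phi> \<phi>_inv by blast
  moreover have "\<F> \<subseteq> ?inv" using type unfolding is_H_type_def type_family_def by (elim conjE)
  ultimately have "type_family G (topspace T) act \<B> H X (insert (sublevel (topspace T) \<phi> r) \<F>)"
    unfolding type_family_def insert_subset using nonempty by (intro conjI)
  \<comment> \<open>The enlarged family is still realized by \<open>x\<close>, so maximality puts
    the new set into the type.\<close>
  then have "insert (sublevel (topspace T) \<phi> r) \<F> = \<F>"
    using type unfolding is_H_type_def by (meson subset_insertI)
  then have mem: "sublevel (topspace T) \<phi> r \<in> \<F>" by (rule subst) simp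
  have "y \<in> sublevel (topspace T) \<psi> (t + \<epsilon>)"
    if \<psi>: "graded_invariant G (topspace T) act H \<psi>" "sublevel (topspace T) \<psi> t \<in> \<F>"
      and y: "y \<in> sublevel (topspace T) \<phi> r \<inter> X" for \<psi> t y
  proof -
    have yT: "y \<in> topspace T" "\<phi> y < r" using y unfolding sublevel_def by auto
    have "\<psi> x < t" using x(2) \<psi>(2) unfolding sublevel_def by blast
    obtain h where h: "h \<in> carrier G" "\<phi>\<^sub>1 (act h y) + H h < r"
      using vaught_delta_less_imp[OF yT(1) _ r(4), of TG act \<phi>\<^sub>1 H] yT(2) topspace_group
      unfolding \<phi>_def by metis
    have hy: "act h y \<in> topspace T" using h yT act_closed by blast
    have "\<phi>\<^sub>1 (act h y) < s" using h(2) graded_subgroup_nonneg[OF H(2) h(1)] r(2) by linarith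
    then have "act h y \<in> N" using \<phi>\<^sub>1(4) hy inv[OF h(1)] y N'(2) unfolding sublevel_def by blast
    then obtain g where g: "g \<in> carrier G" "H g < \<epsilon> / 2" "act h y = act g x"
      using N(3) topspace_group unfolding sublevel_def by auto
    have "H h < \<epsilon> / 2" using h(2) basis_nonneg[OF \<phi>\<^sub>1(1) hy] r(3) by linarith
    moreover have "H (inv h) = H h" using H(2) h(1) unfolding graded_subgroup_def by metis
    moreover have "y = act (inv h) (act g x)" using g(3) h(1) yT(1) act_inv_act by metis
    moreover have "\<psi> (act (inv h) (act g x)) \<le> \<psi> (act g x) \<dotplus> H (inv h)" "\<psi> (act g x) \<le> \<psi> x \<dotplus> H g"
      using \<psi>(1) h(1) g(1) xT act_closed unfolding graded_invariant_def by auto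
    ultimately have "\<psi> y < t + \<epsilon>" using g(2) \<open>\<psi> x < t\<close> unfolding dot_plus_def by simp
    then show ?thesis using yT(1) unfolding sublevel_def by blast
  qed
  then show "\<exists>\<phi>\<in>\<B>. \<exists>r. graded_invariant G (topspace T) act H \<phi> \<and> sublevel (topspace T) \<phi> r \<in> \<F> \<and>
      (\<forall>\<psi>\<in>\<B>. \<forall>t. graded_invariant G (topspace T) act H \<psi> \<and> sublevel (topspace T) \<psi> t \<in> \<F> \<longrightarrow>
        sublevel (topspace T) \<phi> r \<inter> X \<subseteq> sublevel (topspace T) \<psi> (t + \<epsilon>))"
    using \<phi> \<phi>_inv mem by blast
qed

end

section \<open>Single orbits and principal types\<close>

theorem mainTheorem5:
  fixes G :: "('g, 'm) monoid_scheme" and TG :: "'g topology"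
    and G\<^sub>0 :: "'g set" and \<R> :: "('g \<Rightarrow> real) set"
    and \<tau> \<t> :: "'x topology" and act :: "'g \<Rightarrow> 'x \<Rightarrow> 'x"
    and \<B> :: "('x \<Rightarrow> real) set" and A :: "nat \<Rightarrow> 'x set" and X :: "'x set"
  assumes "polish_group G TG"
    and "subgroup G\<^sub>0 G" and "countable G\<^sub>0" and "TG closure_of G\<^sub>0 = topspace TG"
    and "coset_basis G TG G\<^sub>0 \<R>"
    and "polish_G_space G TG \<tau> act"
    and "nice_topology G TG \<R> \<tau> act \<t> \<B>"
    and "basic_enumeration (topspace \<tau>) \<B> A"
    and "X \<in> canonical_partition G (topspace \<tau>) act A"
  shows "X \<in> orbits G (topspace \<tau>) act \<longleftrightarrow>
    (\<forall>H\<in>\<R>. graded_subgroup G H \<and> clopen_graded TG H \<longrightarrow>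
      (\<forall>\<F>. is_H_type G (topspace \<tau>) act \<B> H X \<F> \<longrightarrow>
         principal_H_type G (topspace \<tau>) act \<B> H X \<F>))"
proof -
  have top: "topspace \<tau> = topspace \<t>"
    using assms(7) unfolding nice_topology_def finer_topology_def by simp
  interpret group_action G "topspace \<t>" act
    using assms(6) unfolding polish_G_space_def top by blast
  have grp: "group G" using assms(1) unfolding polish_group_def by blast
  have one_act: "act \<one>\<^bsub>G\<^esub> x = x" if "x \<in> topspace \<t>" for x
    using id_eq_one that by (metis restrict_apply')
  have nice: "nice_basis G TG \<R> \<tau> act \<B>"
    using assms(7) unfolding nice_topology_def by blast
  have G\<^sub>0: "G\<^sub>0 \<subseteq> carrier G" using assms(2) subgroup.subset by blast
  interpret nice_action G TG \<t> act \<R> \<B>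
  proof (intro nice_action.intro continuous_group_action.intro nice_action_axioms.intro
      continuous_group_action_axioms.intro grp)
    fix \<rho> assume "\<rho> \<in> \<R>"
    then have "\<rho> \<in> {graded_coset G H g\<^sub>0 | H g\<^sub>0. H \<in> \<R> \<and> graded_subgroup G H \<and> g\<^sub>0 \<in> G\<^sub>0}"
      using assms(5) unfolding coset_basis_def by blast
    then show "\<exists>H\<in>\<R>. graded_subgroup G H \<and> (\<exists>g\<in>carrier G. \<rho> = graded_coset G H g)"
      using G\<^sub>0 by blast
  next
    fix g h x assume "g \<in> carrier G" "h \<in> carrier G" "x \<in> topspace \<t>"
    then show "act (g \<otimes>\<^bsub>G\<^esub> h) x = act g (act h x)" by (intro composition_rule)
  qed (use assms(1,5,7) nice in \<open>simp_all add: polish_group_def polish_topology_def one_act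
      coset_basis_def nice_topology_def nice_basis_def top\<close>)
  obtain t where X: "X = canonical_set G (topspace \<t>) act A t" "X \<noteq> {}"
    using assms(9) unfolding canonical_partition_def top by blast
  have A: "range A = {sublevel (topspace \<t>) \<phi> r | \<phi> r. \<phi> \<in> \<B> \<and> r \<in> \<rat>}"
    using assms(8) unfolding basic_enumeration_def top .
  have A_open: "openin \<t> (A j)" for j
  proof -
    have "A j \<in> {sublevel (topspace \<t>) \<phi> r | \<phi> r. \<phi> \<in> \<B> \<and> r \<in> \<rat>}" unfolding A[symmetric] by simp
    then obtain \<phi> r where "\<phi> \<in> \<B>" "A j = sublevel (topspace \<t>) \<phi> r" by blast
    then show ?thesis using basis_open unfolding open_graded_def by simp
  qed
  have complete_t: "completely_metrizable_space \<t>"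
    using assms(7) unfolding nice_topology_def polish_topology_def by blast
  have XS: "X \<subseteq> topspace \<t>" unfolding X(1) canonical_set_def by blast
  have X_inv: "act g x \<in> X" if "g \<in> carrier G" "x \<in> X" for g x
    using canonical_set_invariant[OF openin_subset[OF A_open] that(1)] that(2) unfolding X(1) .
  have "gdelta_in \<t> X"
    unfolding X(1)
    by (rule gdelta_in_canonical_set[OF completely_metrizable_imp_metrizable_space[OF complete_t] A_open])
  then have complete_X: "completely_metrizable_space (subtopology \<t> X)"
    by (rule completely_metrizable_space_gdelta_in[OF complete_t])
  have topX: "topspace (subtopology \<t> X) = X" using XS by auto
  interpret piece: continuous_group_action G TG "subtopology \<t> X" act
    by (rule continuous_group_action_subtopology[OF XS X_inv])
  \<comment> \<open>Both directions use this upgrade; they differ in where local density comes from,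
    namely Baire category on an orbit or principality of the types.\<close>
  note open_orbits = piece.locally_dense_imp_locally_open_orbit[OF complete_group
      completely_metrizable_imp_metrizable_space[OF complete_X], unfolded topX]
  have clopen: "clopen_graded TG H" if "H \<in> \<R>" "graded_subgroup G H" for H
    using that assms(5) unfolding coset_basis_def by blast
  show ?thesis
    unfolding top
  proof (intro iffI ballI impI allI)
    fix H \<F>
    assume orbit: "X \<in> orbits G (topspace \<t>) act" and H: "H \<in> \<R>" "graded_subgroup G H \<and> clopen_graded TG H"
      and type: "is_H_type G (topspace \<t>) act \<B> H X \<F>"
    have trans: "\<exists>g\<in>carrier G. y = act g x" if "x \<in> X" "y \<in> X" for x y
    proof -
      obtain z where z: "z \<in> topspace \<t>" "X = orbit G act z" using orbit unfolding orbits_def by blast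
      then obtain g h where gh: "g \<in> carrier G" "x = act g z" "h \<in> carrier G" "y = act h z"
        using \<open>x \<in> X\<close> \<open>y \<in> X\<close> unfolding orbit_def by blast
      then have "y = act (h \<otimes>\<^bsub>G\<^esub> inv\<^bsub>G\<^esub> g) x" using z(1) by (simp add: act_mult act_closed)
      then show ?thesis using gh by blast
    qed
    note dense = piece.transitive_imp_locally_dense_orbit[OF complete_X assms(3) G\<^sub>0 assms(4),
        unfolded topX, OF trans]
    show "principal_H_type G (topspace \<t>) act \<B> H X \<F>"
      using open_orbits_imp_principal_type[OF XS X_inv open_orbits[OF dense] H(1) _ type] H(2) by blast
  next
    assume principal: "\<forall>H\<in>\<R>. graded_subgroup G H \<and> clopen_graded TG H \<longrightarrow>
      (\<forall>\<F>. is_H_type G (topspace \<t>) act \<B> H X \<F> \<longrightarrow> principal_H_type G (topspace \<t>) act \<B> H X \<F>)"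
    have principal': "principal_H_type G (topspace \<t>) act \<B> H X \<F>"
      if "H \<in> \<R>" "graded_subgroup G H" "is_H_type G (topspace \<t>) act \<B> H X \<F>" for H \<F>
      using principal that clopen by blast
    note dense = principal_types_imp_locally_dense[OF XS X_inv principal']
    obtain x where x: "x \<in> X" using X(2) by blast
    have "y \<in> orbit G act x" if y: "y \<in> X" for y
    proof -
      \<comment> \<open>With the whole group as neighbourhood of the identity, the orbit of
        \<open>y\<close> contains a neighbourhood of \<open>y\<close> in \<open>X\<close>. The orbit
        of \<open>x\<close> is dense in \<open>X\<close> and meets it, so the two orbits
        coincide.\<close>
      have "y \<in> subtopology \<t> X interior_of ((\<lambda>g. act g y) ` topspace TG)"
        by (rule open_orbits[OF dense y openin_topspace one_in_topspace])
      then obtain N where N: "openin (subtopology \<t> X) N" "y \<in> N" "N \<subseteq> (\<lambda>g. act g y) ` topspace TG"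
        unfolding interior_of_def by blast
      then obtain N' where N': "openin \<t> N'" "N = N' \<inter> X" unfolding openin_subtopology by blast
      obtain g where g: "g \<in> carrier G" "act g x \<in> N'"
        using canonical_set_dense_orbits[OF A basis X(1) x y N'(1)] N(2) N'(2) by blast
      then have "act g x \<in> N" using X_inv x N'(2) by blast
      then obtain h where h: "h \<in> carrier G" "act g x = act h y" using N(3) topspace_group by auto
      moreover have "x \<in> topspace \<t>" "y \<in> topspace \<t>" using x y XS by auto
      ultimately have "y = act (inv\<^bsub>G\<^esub> h \<otimes>\<^bsub>G\<^esub> g) x" using g(1) by (simp add: act_mult)
      then show ?thesis unfolding orbit_def using g(1) h(1) by blast
    qed
    then have "X = orbit G act x" unfolding orbit_def using X_inv x by blast
    then show "X \<in> orbits G (topspace \<t>) act" unfolding orbits_def using x XS by blast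
  qed
qed

end
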